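(* Let $(S,s)$ be the Cauchy completion of the initial algebra $(G,g)$ for $F=M\otimes -$ on the category $\mathbf{Set}_3$ of tri-pointed sets, with respect to the natural metric on $G$, and let $\psi=s^{-1}$. Then $(S,\psi)$ is the final coalgebra for $F$ on $\mathbf{Set}_3$. Moreover, if $(X,e)$ is an $F$-coalgebra on $\mathbf{Set}_3$, the mediating morphism $f:X\to S$, i.e. the one with $(M\otimes f)\circ e=\psi\circ f$, is given by $f(x)=\lim_{k\to\infty}\theta_k(x)$.
   Context: A tri-pointed set is a set $X$ with three distinguished elements $T,L,R$ (written $T_X,L_X,R_X$). $\mathbf{Set}_3$ is the category of tri-pointed sets and functions preserving $T,L,R$. A tri-pointed metric space is a tri-pointed set with a metric $d$ satisfying $d(x,y)\le 1$ for all $x,y$ and such that any two different ones of the distinguished elements are at distance exactly $1$. Let $M=\{a,b,c\}$. For a tri-pointed set $X$, $M\otimes X$ is the quotient of $M\times X$ by the equivalence relation generated by $(b,T)\sim(a,L)$, $(a,R)\sim(c,T)$, $(c,L)\sim(b,R)$; the class of $(m,x)$ is written $m\otimes x$. Its distinguished elements are $T_{M\otimes X}=a\otimes T$, $L_{M\otimes X}=b\otimes L$, $R_{M\otimes X}=c\otimes R$. If $X$ is a tri-pointed metric space, $M\times X$ has the metric $d((m,x),(n,y))=\frac12 d(x,y)$ if $m=n$ and $1$ if $m\ne n$, and $M\otimes X$ has the quotient metric, which is explicitly: $d(m\otimes x,m\otimes y)=\frac12 d(x,y)$; $d(a\otimes x,b\otimes y)=\frac12\min\{d(x,L)+d(T,y),\,d(x,R)+1+d(R,y)\}$;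 $d(a\otimes x,c\otimes y)=\frac12\min\{d(x,R)+d(T,y),\,d(x,L)+1+d(L,y)\}$; $d(b\otimes x,c\otimes y)=\frac12\min\{d(x,R)+d(L,y),\,d(x,T)+1+d(T,y)\}$. This is again a tri-pointed metric space. The functor $F=M\otimes -$ acts on morphisms by $(M\otimes f)(m\otimes x)=m\otimes f(x)$; $M^n\otimes -$ is its $n$-fold iterate, with elements $m_1\otimes\cdots\otimes m_n\otimes x$. An $F$-coalgebra is a pair $(X,e)$ with $e:X\to F(X)$ a morphism of the category; a coalgebra morphism $(X,e)\to(Y,e')$ is a morphism $f:X\to Y$ with $e'\circ f=F(f)\circ e$; a coalgebra is final if every coalgebra has exactly one coalgebra morphism (the mediating morphism) to it. Let $I=\{T,L,R\}$ with the discrete metric, and $!:I\to M\otimes I$ the map $T\mapsto a\otimes T$, $L\mapsto b\otimes L$, $R\mapsto c\otimes R$. $G$ is the colimit of $I\xrightarrow{!}M\otimes I\xrightarrow{M\otimes !}M^2\otimes I\to\cdots$, i.e. the quotient of the disjoint union of the $M^n\otimes I$ identifying each element with its images along the chain; $[\chi]$ is the class of $\chi$. Distinguished points of $G$: $[T],[L],[R]$. All chain maps are isometric embeddings, and the natural metric of $G$ is $d_G([\chi],[\chi'])=d(\tilde\chi,\tilde\chi')$, where $\tilde\chi,\tilde\chi'$ are images of $\chi,\chi'$ in a common $M^p\otimes I$. The map $g:M\otimes G\to G$, $g(m\otimes[x])=[m\otimes x]$, is an isometric isomorphism and $(G,g)$ is the initial $F$-algebra on $\mathbf{Set}_3$.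 $S$ is the Cauchy completion of $G$ (equivalence classes $[x_n]$ of Cauchy sequences $(x_n)$ in $G$), with distinguished points those of $G$; $s:M\otimes S\to S$ is the isometric isomorphism $s(m\otimes[x_n])=[g(m\otimes x_n)]$. $G$ is regarded as a dense subset of $S$. The sequence $\theta_n(x)$: given a coalgebra $e:X\to M\otimes X$ in $\mathbf{Set}_3$ and $x\in X$, choose inductively $x_0=x$ and, for $n\ge1$, $m_n\in M$ and $x_n\in X$ with $e(x_{n-1})=m_n\otimes x_n$. Put $\theta_n(x)=[m_1\otimes\cdots\otimes m_n\otimes\overline{x_n}]\in G$, where $\overline{x_n}\in I$ is $T$, $L$ or $R$ according as $m_n$ is $a$, $b$ or $c$. The sequence $(\theta_n(x))_n$ is Cauchy in $G$. The representatives may be chosen arbitrarily for each $x$. *)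

theory Defs
  imports "HOL-Analysis.Analysis" "HOL-Library.FSet"
begin

section \<open>Tri-pointed sets\<close>

record 'a tripointed =
  carrier :: "'a set"
  Tpt :: 'a
  Lpt :: 'a
  Rpt :: 'a

text \<open>The three distinguished elements are required to be distinct. Without this the
  one-point coalgebra would admit no point-preserving map to any tri-pointed set with
  distinct distinguished points.\<close>

definition tripointed_set :: "'a tripointed \<Rightarrow> bool" where
  "tripointed_set X \<longleftrightarrow>
     Tpt X \<in> carrier X \<and> Lpt X \<in> carrier X \<and> Rpt X \<in> carrier X \<and>
     Tpt X \<noteq> Lpt X \<and> Tpt X \<noteq> Rpt X \<and> Lpt X \<noteq> Rpt X"

text \<open>Morphisms are extensional functions on the carrier, so that HOL equality of morphisms
  is equality of functions between the carriers.\<close>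

definition morphism :: "'a tripointed \<Rightarrow> 'b tripointed \<Rightarrow> ('a \<Rightarrow> 'b) \<Rightarrow> bool" where
  "morphism X Y f \<longleftrightarrow> f \<in> carrier X \<rightarrow>\<^sub>E carrier Y \<and>
     f (Tpt X) = Tpt Y \<and> f (Lpt X) = Lpt Y \<and> f (Rpt X) = Rpt Y"

section \<open>The functor\<close>

datatype M = Ma | Mb | Mc

definition glue :: "'a tripointed \<Rightarrow> ((M \<times> 'a) \<times> (M \<times> 'a)) set" where
  "glue X = {((Mb, Tpt X), (Ma, Lpt X)),
             ((Ma, Rpt X), (Mc, Tpt X)),
             ((Mc, Lpt X), (Mb, Rpt X))}"

definition glue_equiv :: "'a tripointed \<Rightarrow> ((M \<times> 'a) \<times> (M \<times> 'a)) set" where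
  "glue_equiv X = Restr ((glue X \<union> (glue X)\<inverse>)\<^sup>*) (UNIV \<times> carrier X)"

definition tensor :: "M \<Rightarrow> 'a tripointed \<Rightarrow> 'a \<Rightarrow> (M \<times> 'a) set"
    (\<open>(_ \<otimes>\<^bsub>_\<^esub> _)\<close> [71, 0, 71] 70) where
  "m \<otimes>\<^bsub>X\<^esub> x = glue_equiv X `` {(m, x)}"

definition F_obj :: "'a tripointed \<Rightarrow> (M \<times> 'a) set tripointed" where
  "F_obj X = \<lparr> carrier = (UNIV \<times> carrier X) // glue_equiv X,
               Tpt = Ma \<otimes>\<^bsub>X\<^esub> Tpt X,
               Lpt = Mb \<otimes>\<^bsub>X\<^esub> Lpt X,
               Rpt = Mc \<otimes>\<^bsub>X\<^esub> Rpt X \<rparr>"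

text \<open>The union below is over equal sets, by well-definedness of
  \<open>m \<otimes> x \<mapsto> m \<otimes> f x\<close> on classes.\<close>

definition F_map ::
    "'a tripointed \<Rightarrow> 'b tripointed \<Rightarrow> ('a \<Rightarrow> 'b) \<Rightarrow> (M \<times> 'a) set \<Rightarrow> (M \<times> 'b) set" where
  "F_map X Y f = (\<lambda>z \<in> carrier (F_obj X). \<Union>(m, x)\<in>z. m \<otimes>\<^bsub>Y\<^esub> f x)"

definition coalgebra :: "'a tripointed \<Rightarrow> ('a \<Rightarrow> (M \<times> 'a) set) \<Rightarrow> bool" where
  "coalgebra X e \<longleftrightarrow> tripointed_set X \<and> morphism X (F_obj X) e"

definition coalgebra_morphism ::
    "'a tripointed \<Rightarrow> ('a \<Rightarrow> (M \<times> 'a) set) \<Rightarrow> 'b tripointed \<Rightarrow> ('b \<Rightarrow> (M \<times> 'b) set)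
      \<Rightarrow> ('a \<Rightarrow> 'b) \<Rightarrow> bool" where
  "coalgebra_morphism X e Y e' f \<longleftrightarrow>
     morphism X Y f \<and> (\<forall>x\<in>carrier X. F_map X Y f (e x) = e' (f x))"

text \<open>The metric of \<open>M \<otimes> X\<close>, first on representatives and then on classes, where it does
  not depend on the representatives.\<close>

fun rep_dist ::
    "'a tripointed \<Rightarrow> ('a \<Rightarrow> 'a \<Rightarrow> real) \<Rightarrow> M \<times> 'a \<Rightarrow> M \<times> 'a \<Rightarrow> real" where
  "rep_dist X d (Ma, x) (Ma, y) = d x y / 2"
| "rep_dist X d (Mb, x) (Mb, y) = d x y / 2"
| "rep_dist X d (Mc, x) (Mc, y) = d x y / 2"
| "rep_dist X d (Ma, x) (Mb, y) =
     min (d x (Lpt X) + d (Tpt X) y) (d x (Rpt X) + 1 + d (Rpt X) y) / 2"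
| "rep_dist X d (Ma, x) (Mc, y) =
     min (d x (Rpt X) + d (Tpt X) y) (d x (Lpt X) + 1 + d (Lpt X) y) / 2"
| "rep_dist X d (Mb, x) (Mc, y) =
     min (d x (Rpt X) + d (Lpt X) y) (d x (Tpt X) + 1 + d (Tpt X) y) / 2"
| "rep_dist X d (Mb, y) (Ma, x) =
     min (d x (Lpt X) + d (Tpt X) y) (d x (Rpt X) + 1 + d (Rpt X) y) / 2"
| "rep_dist X d (Mc, y) (Ma, x) =
     min (d x (Rpt X) + d (Tpt X) y) (d x (Lpt X) + 1 + d (Lpt X) y) / 2"
| "rep_dist X d (Mc, y) (Mb, x) =
     min (d x (Rpt X) + d (Lpt X) y) (d x (Tpt X) + 1 + d (Tpt X) y) / 2"

definition F_dist ::
    "'a tripointed \<Rightarrow> ('a \<Rightarrow> 'a \<Rightarrow> real) \<Rightarrow> (M \<times> 'a) set \<Rightarrow> (M \<times> 'a) set \<Rightarrow> real" where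
  "F_dist X d z w = (THE r. \<exists>p\<in>z. \<exists>q\<in>w. r = rep_dist X d p q)"

section \<open>The iterates of the functor on the three-point set\<close>

datatype pt = TopPt | LeftPt | RightPt

text \<open>The types of the iterates \<open>M\<^sup>n \<otimes> I\<close> would grow with \<open>n\<close>. The following type
  contains isomorphic copies of all of them: since the classes making up \<open>M \<otimes> X\<close> have at
  most two elements, \<open>encode\<close> is injective on them, and \<open>decode\<close> is its inverse.\<close>

datatype iter = Base pt | Class "(M \<times> iter) fset"

definition encode :: "(M \<times> iter) set \<Rightarrow> iter" where
  "encode z = Class (Abs_fset z)"

fun decode :: "iter \<Rightarrow> (M \<times> iter) set" where
  "decode (Class z) = fset z"
| "decode (Base p) = {}"

fun Iter :: "nat \<Rightarrow> iter tripointed" where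
  "Iter 0 = \<lparr> carrier = range Base, Tpt = Base TopPt, Lpt = Base LeftPt, Rpt = Base RightPt \<rparr>"
| "Iter (Suc n) =
     \<lparr> carrier = encode ` carrier (F_obj (Iter n)),
       Tpt = encode (Tpt (F_obj (Iter n))),
       Lpt = encode (Lpt (F_obj (Iter n))),
       Rpt = encode (Rpt (F_obj (Iter n))) \<rparr>"

fun iter_dist :: "nat \<Rightarrow> iter \<Rightarrow> iter \<Rightarrow> real" where
  "iter_dist 0 x y = (if x = y then 0 else 1)"
| "iter_dist (Suc n) x y = F_dist (Iter n) (iter_dist n) (decode x) (decode y)"

definition iter_tensor :: "M \<Rightarrow> nat \<Rightarrow> iter \<Rightarrow> iter" where
  "iter_tensor m n x = encode (m \<otimes>\<^bsub>Iter n\<^esub> x)"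

fun corner :: "pt \<Rightarrow> M" where
  "corner TopPt = Ma"
| "corner LeftPt = Mb"
| "corner RightPt = Mc"

fun corner_pt :: "M \<Rightarrow> pt" where
  "corner_pt Ma = TopPt"
| "corner_pt Mb = LeftPt"
| "corner_pt Mc = RightPt"

fun bang :: "iter \<Rightarrow> iter" where
  "bang (Base p) = iter_tensor (corner p) 0 (Base p)"
| "bang (Class z) = undefined"

fun chain :: "nat \<Rightarrow> iter \<Rightarrow> iter" where
  "chain 0 x = bang x"
| "chain (Suc n) x = encode (F_map (Iter n) (Iter (Suc n)) (chain n) (decode x))"

section \<open>The colimit\<close>

definition chain_sum :: "(nat \<times> iter) set" where
  "chain_sum = (SIGMA n:UNIV. carrier (Iter n))"

definition chain_step :: "((nat \<times> iter) \<times> (nat \<times> iter)) set" where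
  "chain_step = {((n, x), (Suc n, chain n x)) | n x. x \<in> carrier (Iter n)}"

definition chain_equiv :: "((nat \<times> iter) \<times> (nat \<times> iter)) set" where
  "chain_equiv = Restr ((chain_step \<union> chain_step\<inverse>)\<^sup>*) chain_sum"

definition colim_class :: "nat \<Rightarrow> iter \<Rightarrow> (nat \<times> iter) set" where
  "colim_class n x = chain_equiv `` {(n, x)}"

type_synonym gpt = "(nat \<times> iter) set"

definition G :: "gpt tripointed" where
  "G = \<lparr> carrier = chain_sum // chain_equiv,
         Tpt = colim_class 0 (Base TopPt),
         Lpt = colim_class 0 (Base LeftPt),
         Rpt = colim_class 0 (Base RightPt) \<rparr>"

text \<open>The value off the carrier is irrelevant, but \<open>Metric_space\<close> asks for a function that is
  symmetric and nonnegative everywhere.\<close>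

definition G_dist :: "gpt \<Rightarrow> gpt \<Rightarrow> real" where
  "G_dist u v =
     (if u \<in> carrier G \<and> v \<in> carrier G
      then THE r. \<exists>p x y. (p, x) \<in> u \<and> (p, y) \<in> v \<and> r = iter_dist p x y
      else 0)"

definition G_alg :: "(M \<times> gpt) set \<Rightarrow> gpt" where
  "G_alg = (\<lambda>z \<in> carrier (F_obj G).
     \<Union>(m, u)\<in>z. \<Union>(n, x)\<in>u. colim_class (Suc n) (iter_tensor m n x))"

section \<open>Cauchy completion\<close>

definition cauchy_seqs :: "'a set \<Rightarrow> ('a \<Rightarrow> 'a \<Rightarrow> real) \<Rightarrow> (nat \<Rightarrow> 'a) set" where
  "cauchy_seqs A d = {\<sigma>. Metric_space.MCauchy A d \<sigma>}"

definition cauchy_equiv ::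
    "'a set \<Rightarrow> ('a \<Rightarrow> 'a \<Rightarrow> real) \<Rightarrow> ((nat \<Rightarrow> 'a) \<times> (nat \<Rightarrow> 'a)) set" where
  "cauchy_equiv A d = {(\<sigma>, \<tau>). \<sigma> \<in> cauchy_seqs A d \<and> \<tau> \<in> cauchy_seqs A d \<and>
                               (\<lambda>n. d (\<sigma> n) (\<tau> n)) \<longlonglongrightarrow> 0}"

definition completion :: "'a set \<Rightarrow> ('a \<Rightarrow> 'a \<Rightarrow> real) \<Rightarrow> (nat \<Rightarrow> 'a) set set" where
  "completion A d = cauchy_seqs A d // cauchy_equiv A d"

definition completion_class ::
    "'a set \<Rightarrow> ('a \<Rightarrow> 'a \<Rightarrow> real) \<Rightarrow> (nat \<Rightarrow> 'a) \<Rightarrow> (nat \<Rightarrow> 'a) set" where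
  "completion_class A d \<sigma> = cauchy_equiv A d `` {\<sigma>}"

definition completion_dist ::
    "'a set \<Rightarrow> ('a \<Rightarrow> 'a \<Rightarrow> real) \<Rightarrow> (nat \<Rightarrow> 'a) set \<Rightarrow> (nat \<Rightarrow> 'a) set \<Rightarrow> real" where
  "completion_dist A d P Q =
     (if P \<in> completion A d \<and> Q \<in> completion A d
      then THE r. \<exists>\<sigma>\<in>P. \<exists>\<tau>\<in>Q. (\<lambda>n. d (\<sigma> n) (\<tau> n)) \<longlonglongrightarrow> r
      else 0)"

definition completion_embed ::
    "'a set \<Rightarrow> ('a \<Rightarrow> 'a \<Rightarrow> real) \<Rightarrow> 'a \<Rightarrow> (nat \<Rightarrow> 'a) set" where
  "completion_embed A d x = completion_class A d (\<lambda>_. x)"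

section \<open>The completion of the initial algebra\<close>

type_synonym spt = "(nat \<Rightarrow> gpt) set"

definition S_class :: "(nat \<Rightarrow> gpt) \<Rightarrow> spt" where
  "S_class = completion_class (carrier G) G_dist"

definition S_embed :: "gpt \<Rightarrow> spt" where
  "S_embed = completion_embed (carrier G) G_dist"

definition S :: "spt tripointed" where
  "S = \<lparr> carrier = completion (carrier G) G_dist,
         Tpt = S_embed (Tpt G),
         Lpt = S_embed (Lpt G),
         Rpt = S_embed (Rpt G) \<rparr>"

definition S_dist :: "spt \<Rightarrow> spt \<Rightarrow> real" where
  "S_dist = completion_dist (carrier G) G_dist"

definition S_alg :: "(M \<times> spt) set \<Rightarrow> spt" where
  "S_alg = (\<lambda>z \<in> carrier (F_obj S).
     \<Union>(m, P)\<in>z. \<Union>\<sigma>\<in>P. S_class (\<lambda>n. G_alg (m \<otimes>\<^bsub>G\<^esub> \<sigma> n)))"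

text \<open>\<open>S_alg\<close> is a bijection between the carriers, so this is its inverse.\<close>

definition S_coalg :: "spt \<Rightarrow> (M \<times> spt) set" where
  "S_coalg = (\<lambda>P \<in> carrier S. inv_into (carrier (F_obj S)) S_alg P)"

section \<open>The approximating sequences\<close>

text \<open>\<open>m k\<close> and \<open>xs k\<close> are the chosen \<open>m\<^sub>k\<close> and \<open>x\<^sub>k\<close>; the value \<open>m 0\<close> is arbitrary.\<close>

definition resolution ::
    "'a tripointed \<Rightarrow> ('a \<Rightarrow> (M \<times> 'a) set) \<Rightarrow> 'a \<Rightarrow> (nat \<Rightarrow> M) \<Rightarrow> (nat \<Rightarrow> 'a) \<Rightarrow> bool" where
  "resolution X e x m xs \<longleftrightarrow> xs 0 = x \<and>
     (\<forall>n\<ge>1. xs n \<in> carrier X \<and> e (xs (n - 1)) = m n \<otimes>\<^bsub>X\<^esub> xs n)"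

fun word_tensor :: "M list \<Rightarrow> pt \<Rightarrow> iter" where
  "word_tensor [] p = Base p"
| "word_tensor (m # w) p = iter_tensor m (length w) (word_tensor w p)"

definition theta :: "(nat \<Rightarrow> M) \<Rightarrow> nat \<Rightarrow> gpt" where
  "theta m n = colim_class n (word_tensor (map m [1..<Suc n]) (corner_pt (m n)))"

end

theory Submission
  imports Defs
begin

text \<open>The map \<open>(m, u) \<mapsto> s (m \<otimes> u)\<close> halves distances within each copy, so for a coalgebra morphism
  \<open>f\<close> with \<open>f x = s (m\<^sub>1 \<otimes> f x\<^sub>1)\<close> and so on, \<open>f x\<close> and \<open>\<theta>\<^sub>k x\<close> are at distance at most \<open>2\<^sup>-\<^sup>k\<close>: both arise
  by applying the same \<open>k\<close> contractions to points at distance at most \<open>1\<close>. This gives the limit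
  formula and, since limits are unique, uniqueness. For existence, one step of the coalgebra is
  chosen at every point; the resulting Cauchy sequences in \<open>G\<close> define points of \<open>S\<close>, and shifting
  such a sequence gives the morphism equation. That \<open>s\<close> is onto follows from the pigeonhole principle: a Cauchy sequence in \<open>G\<close> has a
  subsequence within one of the three copies.\<close>

section \<open>The functor on tri-pointed sets and metrics\<close>

text \<open>\<open>morphism\<close> without extensionality, for maps such as
  \<open>colim_class n\<close> that are not cut off outside a carrier.\<close>

definition point_preserving :: "'a tripointed \<Rightarrow> 'b tripointed \<Rightarrow> ('a \<Rightarrow> 'b) \<Rightarrow> bool" where
  "point_preserving X Y f \<longleftrightarrow> f \<in> carrier X \<rightarrow> carrier Y \<and>
     f (Tpt X) = Tpt Y \<and> f (Lpt X) = Lpt Y \<and> f (Rpt X) = Rpt Y"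

lemma morphism_iff: "morphism X Y f \<longleftrightarrow> point_preserving X Y f \<and> f \<in> extensional (carrier X)"
  by (auto simp: morphism_def point_preserving_def PiE_def)

text \<open>Since the distinguished elements are distinct, the six glued pairs are pairwise
  different. Two consecutive gluing steps therefore lead back to the start, and the closure adds
  only the diagonal.\<close>

lemma glue_equiv_iff:
  assumes "tripointed_set X"
  shows "(p, q) \<in> glue_equiv X \<longleftrightarrow>
    p \<in> UNIV \<times> carrier X \<and> q \<in> UNIV \<times> carrier X \<and> (p = q \<or> (p, q) \<in> glue X \<or> (q, p) \<in> glue X)"
proof -
  have square: "z = x" if "(x, y) \<in> glue X \<union> (glue X)\<inverse>" "(y, z) \<in> glue X \<union> (glue X)\<inverse>" for x y z
    using that assms unfolding glue_def tripointed_set_def by (cases x; cases y; cases z) auto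
  have "r = p \<or> (p, r) \<in> glue X \<union> (glue X)\<inverse>" if "(p, r) \<in> (glue X \<union> (glue X)\<inverse>)\<^sup>*" for r
    using that by induction (use square in blast)+
  then show ?thesis
    unfolding glue_equiv_def by auto
qed

lemma equiv_glue_equiv: "equiv (UNIV \<times> carrier X) (glue_equiv X)"
proof (rule equivI)
  have "sym ((glue X \<union> (glue X)\<inverse>)\<^sup>*)"
    by (intro sym_rtrancl sym_Un_converse)
  then show "sym (glue_equiv X)"
    unfolding glue_equiv_def sym_def by blast
qed (auto simp: glue_equiv_def refl_on_def trans_def intro: rtrancl_trans)

lemma tensor_eq_iff:
  assumes "x \<in> carrier X" "y \<in> carrier X"
  shows "m \<otimes>\<^bsub>X\<^esub> x = n \<otimes>\<^bsub>X\<^esub> y \<longleftrightarrow> ((m, x), (n, y)) \<in> glue_equiv X"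
  unfolding tensor_def using assms by (intro eq_equiv_class_iff[OF equiv_glue_equiv]) auto

lemma tensor_glue:
  assumes "tripointed_set X"
  shows "Mb \<otimes>\<^bsub>X\<^esub> Tpt X = Ma \<otimes>\<^bsub>X\<^esub> Lpt X"
    "Ma \<otimes>\<^bsub>X\<^esub> Rpt X = Mc \<otimes>\<^bsub>X\<^esub> Tpt X"
    "Mc \<otimes>\<^bsub>X\<^esub> Lpt X = Mb \<otimes>\<^bsub>X\<^esub> Rpt X"
  using assms by (auto simp: tensor_eq_iff glue_equiv_iff tripointed_set_def glue_def)

lemma tensor_in_F_obj [intro]: "x \<in> carrier X \<Longrightarrow> m \<otimes>\<^bsub>X\<^esub> x \<in> carrier (F_obj X)"
  by (auto simp: F_obj_def tensor_def intro: quotientI)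

lemma F_obj_cases:
  assumes "z \<in> carrier (F_obj X)"
  obtains m x where "x \<in> carrier X" "z = m \<otimes>\<^bsub>X\<^esub> x"
  using assms by (auto simp: F_obj_def tensor_def elim!: quotientE)

text \<open>This evaluates \<open>F_map\<close>, \<open>G_alg\<close> and \<open>S_alg\<close>,
  which are unions over a class. Only the three gluings link different representatives, so
  compatibility with them makes the family constant.\<close>

lemma UN_tensor:
  assumes "tripointed_set X" "x \<in> carrier X"
    and "h Mb (Tpt X) = h Ma (Lpt X)" "h Ma (Rpt X) = h Mc (Tpt X)" "h Mc (Lpt X) = h Mb (Rpt X)"
  shows "(\<Union>(n, y)\<in>m \<otimes>\<^bsub>X\<^esub> x. h n y) = h m x"
proof -
  have "h n y = h m x" if "(n, y) \<in> m \<otimes>\<^bsub>X\<^esub> x" for n y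
    using that assms by (auto simp: tensor_def glue_equiv_iff glue_def)
  moreover have "(m, x) \<in> m \<otimes>\<^bsub>X\<^esub> x"
    using assms by (auto simp: tensor_def glue_equiv_iff)
  ultimately show ?thesis
    by blast
qed

text \<open>\<open>encode\<close> uses \<open>Abs_fset\<close>, which is invertible on finite sets.
  A class consists of its representative and some of the six glued pairs.\<close>

lemma finite_F_obj:
  assumes "tripointed_set X" "z \<in> carrier (F_obj X)"
  shows "finite z"
proof -
  obtain m x where "x \<in> carrier X" "z = m \<otimes>\<^bsub>X\<^esub> x"
    using F_obj_cases assms(2) .
  then have "z \<subseteq> insert (m, x) (Domain (glue X) \<union> Range (glue X))"
    using assms(1) by (auto simp: tensor_def glue_equiv_iff)
  moreover have "finite (Domain (glue X) \<union> Range (glue X))"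
    by (simp add: glue_def)
  ultimately show ?thesis
    using finite_subset by blast
qed

lemma tripointed_F_obj:
  assumes "tripointed_set X"
  shows "tripointed_set (F_obj X)"
  using assms tensor_in_F_obj[of _ X]
  by (auto simp: tripointed_set_def F_obj_def tensor_eq_iff glue_equiv_iff glue_def)

lemma F_map_tensor:
  assumes "tripointed_set X" "tripointed_set Y" "point_preserving X Y f" "x \<in> carrier X"
  shows "F_map X Y f (m \<otimes>\<^bsub>X\<^esub> x) = m \<otimes>\<^bsub>Y\<^esub> f x"
  using assms tensor_glue[of Y] UN_tensor[of X x "\<lambda>m x. m \<otimes>\<^bsub>Y\<^esub> f x" m]
  by (auto simp: F_map_def point_preserving_def tensor_in_F_obj)

text \<open>The point of \<open>X\<close> at which the copy \<open>m\<close> is glued to the copy \<open>n\<close>; the value for \<open>m = n\<close> is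
  arbitrary. It replaces the three distance formulas between different copies by a single one.\<close>

fun joint :: "'a tripointed \<Rightarrow> M \<Rightarrow> M \<Rightarrow> 'a" where
  "joint X Ma n = (if n = Mb then Lpt X else Rpt X)"
| "joint X Mb n = (if n = Ma then Tpt X else Rpt X)"
| "joint X Mc n = (if n = Ma then Tpt X else Lpt X)"

text \<open>The axioms are restricted to the carrier, because \<open>F_dist\<close> is undetermined outside it, so
  that \<open>Metric_space\<close> does not apply.\<close>

locale tripointed_metric =
  fixes X :: "'a tripointed" and d :: "'a \<Rightarrow> 'a \<Rightarrow> real"
  assumes tripointed: "tripointed_set X"
    and zero: "\<And>x y. x \<in> carrier X \<Longrightarrow> y \<in> carrier X \<Longrightarrow> d x y = 0 \<longleftrightarrow> x = y"
    and sym: "\<And>x y. x \<in> carrier X \<Longrightarrow> y \<in> carrier X \<Longrightarrow> d x y = d y x"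
    and triangle: "\<And>x y z. x \<in> carrier X \<Longrightarrow> y \<in> carrier X \<Longrightarrow> z \<in> carrier X \<Longrightarrow>
      d x z \<le> d x y + d y z"
    and le_one: "\<And>x y. x \<in> carrier X \<Longrightarrow> y \<in> carrier X \<Longrightarrow> d x y \<le> 1"
    and corners: "d (Tpt X) (Lpt X) = 1" "d (Tpt X) (Rpt X) = 1" "d (Lpt X) (Rpt X) = 1"
begin

lemma pts [simp]: "Tpt X \<in> carrier X" "Lpt X \<in> carrier X" "Rpt X \<in> carrier X"
  using tripointed by (auto simp: tripointed_set_def)

lemma pts_distinct [simp]:
  "Tpt X \<noteq> Lpt X" "Tpt X \<noteq> Rpt X" "Lpt X \<noteq> Rpt X"
  "Lpt X \<noteq> Tpt X" "Rpt X \<noteq> Tpt X" "Rpt X \<noteq> Lpt X"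
  using tripointed by (auto simp: tripointed_set_def)

lemma refl [simp]: "x \<in> carrier X \<Longrightarrow> d x x = 0"
  by (simp add: zero)

lemma nonneg: "x \<in> carrier X \<Longrightarrow> y \<in> carrier X \<Longrightarrow> 0 \<le> d x y"
  using triangle[of x y x] sym[of x y] by simp

section \<open>The metric on \<open>M \<otimes> X\<close>\<close>

lemma rep_dist_sym:
  assumes "x \<in> carrier X" "y \<in> carrier X"
  shows "rep_dist X d (m, x) (n, y) = rep_dist X d (n, y) (m, x)"
  using assms by (cases m; cases n) (auto simp: sym)

lemma rep_dist_le_one:
  assumes "x \<in> carrier X" "y \<in> carrier X"
  shows "rep_dist X d (m, x) (n, y) \<le> 1"
proof -
  have "d u x \<le> 1" "d x u \<le> 1" "d u y \<le> 1" "d y u \<le> 1" "d x y \<le> 1" "d y x \<le> 1"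
    if "u \<in> carrier X" for u
    using assms that le_one by auto
  from this(1-4)[OF pts(1)] this(1-4)[OF pts(2)] this(1-4)[OF pts(3)] this(5,6)[OF pts(1)]
  show ?thesis
    by (cases m; cases n) (auto simp: min_def)
qed

lemma joint_in [simp]: "joint X m n \<in> carrier X"
  by (cases m) auto

lemma joint_dist:
  assumes "m \<noteq> l" "n \<noteq> l" "m \<noteq> n"
  shows "d (joint X l m) (joint X l n) = 1"
  using assms corners sym[of "Rpt X" "Lpt X"] sym[of "Rpt X" "Tpt X"] sym[of "Lpt X" "Tpt X"]
  by (cases l; cases m; cases n) auto

lemma rep_dist_same: "rep_dist X d (m, x) (m, y) = d x y / 2"
  by (cases m) auto

text \<open>The two terms are the lengths of the direct path and of the path through the third copy \<open>l\<close>.\<close>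

lemma rep_dist_diff:
  assumes "x \<in> carrier X" "y \<in> carrier X" "m \<noteq> l" "n \<noteq> l" "m \<noteq> n"
  shows "rep_dist X d (m, x) (n, y) =
    min (d x (joint X m n) + d (joint X n m) y) (d x (joint X m l) + 1 + d (joint X n l) y) / 2"
  using assms sym pts by (cases m; cases n; cases l; simp add: add.commute)

text \<open>The cases differ in which copies coincide. If the middle point shares a copy with an
  endpoint, the triangle inequality at the joints suffices. A path that leaves copy \<open>l\<close>
  and returns either uses one joint twice or has length at least 1 before halving, and
  \<open>d x z\<close> is at most 1.\<close>

lemma rep_dist_triangle:
  assumes x: "x \<in> carrier X" and y: "y \<in> carrier X" and z: "z \<in> carrier X"
  shows "rep_dist X d (l, x) (n, z) \<le> rep_dist X d (l, x) (m, y) + rep_dist X d (m, y) (n, z)"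
proof -
  have third: "\<exists>k. k \<noteq> i \<and> k \<noteq> j" for i j :: M
    by (cases i; cases j) (metis M.distinct)+
  consider "l = m" "m = n" | k where "l = m" "m \<noteq> n" "k \<noteq> l" "k \<noteq> n"
    | k where "l \<noteq> m" "m = n" "k \<noteq> l" "k \<noteq> n"
    | k where "l = n" "m \<noteq> n" "k \<noteq> l" "k \<noteq> m"
    | "l \<noteq> m" "m \<noteq> n" "l \<noteq> n"
    using third by metis
  then show ?thesis
  proof cases
    case 1
    then show ?thesis using triangle[OF x y z] by (simp add: rep_dist_same)
  next
    case 2
    then show ?thesis
      using triangle[OF x y joint_in[of l n]] triangle[OF x y joint_in[of l k]]
      by (simp add: rep_dist_same rep_dist_diff[of _ _ _ k] x y z min_def)
  next
    case 3
    then show ?thesis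
      using triangle[OF joint_in[of n l] y z] triangle[OF joint_in[of n k] y z]
      by (simp add: rep_dist_same rep_dist_diff[of _ _ _ k] x y z min_def)
  next
    case 4
    then show ?thesis
      using triangle[OF x joint_in[of l m] z] triangle[OF x joint_in[of l k] z] le_one[OF x z]
        nonneg[OF x joint_in[of l m]] nonneg[OF x joint_in[of l k]]
        nonneg[OF joint_in[of l m] z] nonneg[OF joint_in[of l k] z]
        nonneg[OF joint_in[of m l] y] nonneg[OF joint_in[of m k] y]
        nonneg[OF y joint_in[of m l]] nonneg[OF y joint_in[of m k]]
      by (simp add: rep_dist_same rep_dist_diff[of _ _ _ k] x y z min_def)
  next
    case 5
    \<comment> \<open>Crossing copy \<open>m\<close> from one joint to the other costs at least 1.
      This pays for the constant 1 in the path from \<open>l\<close> to \<open>n\<close> through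
      \<open>m\<close>.\<close>
    have 1: "1 \<le> d (joint X m l) y + d y (joint X m n)" "1 \<le> d (joint X m n) y + d y (joint X m l)"
      using triangle[OF joint_in[of m l] y joint_in[of m n]] triangle[OF joint_in[of m n] y joint_in[of m l]]
        joint_dist[of l m n] joint_dist[of n m l] 5
      by auto
    show ?thesis
      using 5 1 le_one[OF x joint_in[of l n]] le_one[OF joint_in[of n l] z]
        le_one[OF x joint_in[of l m]] le_one[OF joint_in[of n m] z]
        nonneg[OF x joint_in[of l n]] nonneg[OF joint_in[of n l] z]
        nonneg[OF x joint_in[of l m]] nonneg[OF joint_in[of n m] z]
        nonneg[OF y joint_in[of m n]] nonneg[OF y joint_in[of m l]]
        nonneg[OF joint_in[of m n] y] nonneg[OF joint_in[of m l] y]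
      by (simp add: rep_dist_diff[of _ _ l n m] rep_dist_diff[of _ _ l m n] rep_dist_diff[of _ _ m l n] x y z min_def)
  qed
qed

text \<open>On representatives there is only a pseudometric, whose kernel is the gluing relation:
  the path through the third copy has positive length, so distance 0 between different copies forces
  both points onto their common joint.\<close>

lemma rep_dist_zero:
  assumes "x \<in> carrier X" "y \<in> carrier X"
  shows "rep_dist X d (m, x) (n, y) = 0 \<longleftrightarrow> ((m, x), (n, y)) \<in> glue_equiv X"
proof (cases "m = n")
  case True
  then show ?thesis
    using assms zero tripointed by (auto simp: rep_dist_same glue_equiv_iff glue_def)
next
  case False
  obtain l where "m \<noteq> l" "n \<noteq> l"
    by (cases m; cases n) (metis M.distinct)+
  then have "rep_dist X d (m, x) (n, y) = 0 \<longleftrightarrow> d x (joint X m n) = 0 \<and> d (joint X n m) y = 0"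
    using False assms nonneg[of x "joint X m n"] nonneg[of "joint X n m" y]
      nonneg[of x "joint X m l"] nonneg[of "joint X n l" y]
    by (subst rep_dist_diff[of x y m l n]) (auto simp: min_def)
  also have "\<dots> \<longleftrightarrow> x = joint X m n \<and> y = joint X n m"
    using assms zero by auto
  also have "\<dots> \<longleftrightarrow> ((m, x), (n, y)) \<in> glue_equiv X"
    using False assms tripointed by (cases m; cases n) (auto simp: glue_equiv_iff glue_def)
  finally show ?thesis .
qed

text \<open>The definite description in \<open>F_dist\<close> is well defined: glued pairs are at
  distance 0, so by the triangle inequality exchanging them changes no distance.\<close>

lemma F_dist_tensor:
  assumes x: "x \<in> carrier X" and y: "y \<in> carrier X"
  shows "F_dist X d (m \<otimes>\<^bsub>X\<^esub> x) (n \<otimes>\<^bsub>X\<^esub> y) = rep_dist X d (m, x) (n, y)"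
proof -
  have eq: "rep_dist X d (m, x) (n, y) = rep_dist X d p q"
    if "p \<in> m \<otimes>\<^bsub>X\<^esub> x" "q \<in> n \<otimes>\<^bsub>X\<^esub> y" for p q
  proof -
    obtain k u l v where p: "p = (k, u)" and q: "q = (l, v)"
      by fastforce
    have pq: "((m, x), (k, u)) \<in> glue_equiv X" "((n, y), (l, v)) \<in> glue_equiv X"
      using that by (auto simp: tensor_def p q)
    then have uv: "u \<in> carrier X" "v \<in> carrier X"
      by (auto simp: glue_equiv_def)
    then have "rep_dist X d (m, x) (k, u) = 0" "rep_dist X d (n, y) (l, v) = 0"
      using rep_dist_zero pq x y by auto
    then show ?thesis
      unfolding p q
      using rep_dist_triangle[OF x uv(1) y, of m n k] rep_dist_triangle[OF uv(1) uv(2) y, of k n l]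
        rep_dist_triangle[OF uv(1) x uv(2), of k l m] rep_dist_triangle[OF x y uv(2), of m l n]
        rep_dist_sym[OF x uv(1), of m k] rep_dist_sym[OF y uv(2), of n l]
      by linarith
  qed
  have "(m, x) \<in> m \<otimes>\<^bsub>X\<^esub> x" "(n, y) \<in> n \<otimes>\<^bsub>X\<^esub> y"
    using x y tripointed by (auto simp: tensor_def glue_equiv_iff)
  then have "\<exists>p\<in>m \<otimes>\<^bsub>X\<^esub> x. \<exists>q\<in>n \<otimes>\<^bsub>X\<^esub> y. rep_dist X d (m, x) (n, y) = rep_dist X d p q"
    by (intro bexI[of _ "(m, x)"] bexI[of _ "(n, y)"]) simp_all
  moreover have "r = rep_dist X d (m, x) (n, y)"
    if r: "\<exists>p\<in>m \<otimes>\<^bsub>X\<^esub> x. \<exists>q\<in>n \<otimes>\<^bsub>X\<^esub> y. r = rep_dist X d p q" for r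
  proof -
    obtain p q where "p \<in> m \<otimes>\<^bsub>X\<^esub> x" "q \<in> n \<otimes>\<^bsub>X\<^esub> y" "r = rep_dist X d p q"
      using r by blast
    with eq[of p q] show ?thesis by simp
  qed
  ultimately show ?thesis
    unfolding F_dist_def by (rule the_equality)
qed

lemma tripointed_metric_F: "tripointed_metric (F_obj X) (F_dist X d)"
proof
  fix z w v
  assume "z \<in> carrier (F_obj X)" "w \<in> carrier (F_obj X)" "v \<in> carrier (F_obj X)"
  then obtain m x n y l u where c: "x \<in> carrier X" "y \<in> carrier X" "u \<in> carrier X" and
    "z = m \<otimes>\<^bsub>X\<^esub> x" "w = n \<otimes>\<^bsub>X\<^esub> y" "v = l \<otimes>\<^bsub>X\<^esub> u"
    by (metis F_obj_cases)
  then show "F_dist X d z v \<le> F_dist X d z w + F_dist X d w v"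
    using F_dist_tensor rep_dist_triangle by auto
next
  fix z w
  assume "z \<in> carrier (F_obj X)" "w \<in> carrier (F_obj X)"
  then obtain m x n y where "x \<in> carrier X" "y \<in> carrier X" "z = m \<otimes>\<^bsub>X\<^esub> x" "w = n \<otimes>\<^bsub>X\<^esub> y"
    by (metis F_obj_cases)
  then show "F_dist X d z w = 0 \<longleftrightarrow> z = w" "F_dist X d z w = F_dist X d w z" "F_dist X d z w \<le> 1"
    by (simp_all add: F_dist_tensor rep_dist_le_one tensor_eq_iff rep_dist_sym[of x y]
        flip: rep_dist_zero)
\<comment> \<open>A corner is at distance 1 from both joints of its copy, so the halved direct path
  between two corners has length 1, and the other path is longer.\<close>
qed (use tripointed tripointed_F_obj corners sym[of "Lpt X" "Tpt X"] sym[of "Rpt X" "Tpt X"]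
    sym[of "Rpt X" "Lpt X"] in \<open>auto simp: F_obj_def F_dist_tensor\<close>)

lemma tripointed_metric_image:
  assumes "bij_betw h (carrier X) (carrier Y)"
    and "h (Tpt X) = Tpt Y" "h (Lpt X) = Lpt Y" "h (Rpt X) = Rpt Y"
    and dist: "\<And>x y. x \<in> carrier X \<Longrightarrow> y \<in> carrier X \<Longrightarrow> d' (h x) (h y) = d x y"
  shows "tripointed_metric Y d'"
proof -
  have Y: "carrier Y = h ` carrier X" and inj: "inj_on h (carrier X)"
    using assms(1) by (auto simp: bij_betw_def)
  have "tripointed_set Y"
    using inj unfolding tripointed_set_def assms(2-4)[symmetric] Y
    by (auto simp: inj_on_eq_iff)
  then show ?thesis
    using inj triangle corners
    by unfold_locales (auto simp: Y assms(2-4)[symmetric] dist zero sym le_one inj_on_eq_iff)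
qed

text \<open>\<open>rep_dist\<close> involves only distances among the two points and the
  distinguished elements.\<close>

lemma rep_dist_isometry:
  assumes "point_preserving X Y f"
    and dist: "\<And>x y. x \<in> carrier X \<Longrightarrow> y \<in> carrier X \<Longrightarrow> d' (f x) (f y) = d x y"
    and "x \<in> carrier X" "y \<in> carrier X"
  shows "rep_dist Y d' (m, f x) (n, f y) = rep_dist X d (m, x) (n, y)"
proof -
  note f = assms(1)[unfolded point_preserving_def, THEN conjunct2, THEN conjunct1, symmetric]
    assms(1)[unfolded point_preserving_def, THEN conjunct2, THEN conjunct2, THEN conjunct1, symmetric]
    assms(1)[unfolded point_preserving_def, THEN conjunct2, THEN conjunct2, THEN conjunct2, symmetric]
  show ?thesis
    using assms(3,4) by (cases m; cases n) (simp_all add: f dist)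
qed

end

section \<open>The iterates of the functor on the three-point set and the chain maps\<close>

lemma encode_decode:
  assumes "tripointed_set X" "z \<in> carrier (F_obj X)"
  shows "decode (encode z) = z"
  using finite_F_obj[OF assms] by (simp add: encode_def Abs_fset_inverse)

lemma encode_decode_tensor:
  assumes "tripointed_set X" "x \<in> carrier X"
  shows "decode (encode (m \<otimes>\<^bsub>X\<^esub> x)) = m \<otimes>\<^bsub>X\<^esub> x"
  using encode_decode[OF assms(1) tensor_in_F_obj[OF assms(2)]] .

lemma tripointed_metric_Iter: "tripointed_metric (Iter n) (iter_dist n)"
proof (induction n)
  case 0
  show ?case
    by unfold_locales (auto simp: tripointed_set_def)
next
  case (Suc n)
  then interpret tripointed_metric "Iter n" "iter_dist n" .
  interpret F: tripointed_metric "F_obj (Iter n)" "F_dist (Iter n) (iter_dist n)"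
    by (rule tripointed_metric_F)
  have "inj_on encode (carrier (F_obj (Iter n)))"
    by (rule inj_on_inverseI) (rule encode_decode[OF tripointed])
  then show ?case
    by (intro F.tripointed_metric_image[of encode]) (auto simp: bij_betw_def encode_decode[OF tripointed])
qed

interpretation Iter: tripointed_metric "Iter n" "iter_dist n" for n
  by (rule tripointed_metric_Iter)

lemma iter_tensor_in [intro]: "x \<in> carrier (Iter n) \<Longrightarrow> iter_tensor m n x \<in> carrier (Iter (Suc n))"
  by (auto simp: iter_tensor_def tensor_in_F_obj)

lemma Iter_Suc_cases:
  assumes "x \<in> carrier (Iter (Suc n))"
  obtains m y where "y \<in> carrier (Iter n)" "x = iter_tensor m n y"
  using assms by (auto simp: iter_tensor_def elim!: F_obj_cases)

lemma iter_tensor_glue: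
  "iter_tensor Mb n (Tpt (Iter n)) = iter_tensor Ma n (Lpt (Iter n))"
  "iter_tensor Ma n (Rpt (Iter n)) = iter_tensor Mc n (Tpt (Iter n))"
  "iter_tensor Mc n (Lpt (Iter n)) = iter_tensor Mb n (Rpt (Iter n))"
  by (simp_all add: iter_tensor_def tensor_glue[OF Iter.tripointed])

lemma Iter_Suc_pts:
  "Tpt (Iter (Suc n)) = iter_tensor Ma n (Tpt (Iter n))"
  "Lpt (Iter (Suc n)) = iter_tensor Mb n (Lpt (Iter n))"
  "Rpt (Iter (Suc n)) = iter_tensor Mc n (Rpt (Iter n))"
  by (simp_all add: iter_tensor_def F_obj_def)

lemma iter_dist_tensor:
  assumes "x \<in> carrier (Iter n)" "y \<in> carrier (Iter n)"
  shows "iter_dist (Suc n) (iter_tensor m n x) (iter_tensor k n y) =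
    rep_dist (Iter n) (iter_dist n) (m, x) (k, y)"
  using assms by (simp add: iter_tensor_def encode_decode_tensor[OF Iter.tripointed] Iter.F_dist_tensor)

text \<open>\<open>chain (Suc n)\<close> is the functor applied to \<open>chain n\<close>. Point
  preservation at level \<open>n\<close> is what \<open>F_map_tensor\<close> needs for commutation
  with \<open>iter_tensor\<close>, and this commutation reduces the claims for level
  \<open>Suc n\<close> to those for level \<open>n\<close>.\<close>

lemma chain_props:
  "point_preserving (Iter n) (Iter (Suc n)) (chain n)" (is "?P n")
  "\<lbrakk>x \<in> carrier (Iter n); y \<in> carrier (Iter n)\<rbrakk> \<Longrightarrow> iter_dist (Suc n) (chain n x) (chain n y) = iter_dist n x y"
  "x \<in> carrier (Iter n) \<Longrightarrow> chain (Suc n) (iter_tensor m n x) = iter_tensor m (Suc n) (chain n x)"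
proof -
  have tensor: "chain (Suc n) (iter_tensor m n x) = iter_tensor m (Suc n) (chain n x)"
    if "?P n" "x \<in> carrier (Iter n)" for n m x
    using that F_map_tensor[OF Iter.tripointed Iter.tripointed]
    by (simp del: Iter.simps add: iter_tensor_def encode_decode_tensor[OF Iter.tripointed])
  have *: "?P n \<and> (\<forall>x\<in>carrier (Iter n). \<forall>y\<in>carrier (Iter n).
      iter_dist (Suc n) (chain n x) (chain n y) = iter_dist n x y)"
  proof (induction n)
    case 0
    have P: "?P 0"
      unfolding point_preserving_def Iter_Suc_pts
      by (auto intro!: iter_tensor_in simp del: Iter.simps(2))
    have "iter_dist 1 (bang (Base p)) (bang (Base q)) = iter_dist 0 (Base p) (Base q)" for p q
      unfolding bang.simps One_nat_def
      by (cases p; cases q; subst iter_dist_tensor) auto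
    then show ?case using P by (auto simp del: iter_dist.simps bang.simps)
  next
    case (Suc n)
    then have P: "?P n" and d: "\<And>x y. x \<in> carrier (Iter n) \<Longrightarrow> y \<in> carrier (Iter n) \<Longrightarrow>
      iter_dist (Suc n) (chain n x) (chain n y) = iter_dist n x y"
      by auto
    have in': "chain n x \<in> carrier (Iter (Suc n))" if "x \<in> carrier (Iter n)" for x
      using P that by (auto simp: point_preserving_def)
    have "chain (Suc n) z \<in> carrier (Iter (Suc (Suc n)))" if "z \<in> carrier (Iter (Suc n))" for z
    proof -
      obtain m x where "x \<in> carrier (Iter n)" "z = iter_tensor m n x"
        using Iter_Suc_cases \<open>z \<in> carrier (Iter (Suc n))\<close> .
      then show ?thesis
        unfolding \<open>z = _\<close> tensor[OF P \<open>x \<in> _\<close>] by (intro iter_tensor_in in')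
    qed
    moreover have "chain (Suc n) (Tpt (Iter (Suc n))) = Tpt (Iter (Suc (Suc n)))"
      "chain (Suc n) (Lpt (Iter (Suc n))) = Lpt (Iter (Suc (Suc n)))"
      "chain (Suc n) (Rpt (Iter (Suc n))) = Rpt (Iter (Suc (Suc n)))"
      using P unfolding Iter_Suc_pts[of "Suc n"]
      by (simp_all add: Iter_Suc_pts[of n] tensor[OF P] point_preserving_def del: chain.simps Iter.simps)
    ultimately have "?P (Suc n)"
      unfolding point_preserving_def by blast
    moreover have "iter_dist (Suc (Suc n)) (chain (Suc n) z) (chain (Suc n) w) = iter_dist (Suc n) z w"
      if "z \<in> carrier (Iter (Suc n))" "w \<in> carrier (Iter (Suc n))" for z w
    proof -
      obtain m x k y where "x \<in> carrier (Iter n)" "y \<in> carrier (Iter n)"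
        "z = iter_tensor m n x" "w = iter_tensor k n y"
        using Iter_Suc_cases[OF \<open>z \<in> carrier (Iter (Suc n))\<close>] Iter_Suc_cases[OF \<open>w \<in> carrier (Iter (Suc n))\<close>]
        by metis
      then show ?thesis
        by (simp add: tensor[OF P] iter_dist_tensor in' Iter.rep_dist_isometry[OF P d]
            del: chain.simps Iter.simps iter_dist.simps)
    qed
    ultimately show ?case by blast
  qed
  then show "?P n" by blast
  show "\<lbrakk>x \<in> carrier (Iter n); y \<in> carrier (Iter n)\<rbrakk> \<Longrightarrow> iter_dist (Suc n) (chain n x) (chain n y) = iter_dist n x y"
    using * by blast
  show "x \<in> carrier (Iter n) \<Longrightarrow> chain (Suc n) (iter_tensor m n x) = iter_tensor m (Suc n) (chain n x)"
    using tensor * by blast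
qed

section \<open>The colimit\<close>

lemma chain_in: "x \<in> carrier (Iter n) \<Longrightarrow> chain n x \<in> carrier (Iter (Suc n))"
  using chain_props(1)[of n] by (auto simp: point_preserving_def)

text \<open>The composite of the chain maps from level \<open>n\<close> to level \<open>p\<close>; for \<open>p < n\<close> it is the
  identity, a junk value.\<close>

primrec up :: "nat \<Rightarrow> nat \<Rightarrow> iter \<Rightarrow> iter" where
  "up n 0 x = x"
| "up n (Suc p) x = (if n \<le> p then chain p (up n p x) else x)"

lemma up_self [simp]: "up n n x = x"
  by (cases n) auto

lemma up_in: "n \<le> p \<Longrightarrow> x \<in> carrier (Iter n) \<Longrightarrow> up n p x \<in> carrier (Iter p)"
  by (induction rule: dec_induct) (auto simp: chain_in simp del: Iter.simps chain.simps)

lemma up_up: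
  assumes "n \<le> p" "p \<le> q"
  shows "up p q (up n p x) = up n q x"
  using assms(2,1) by (induction rule: dec_induct) (auto simp del: chain.simps)

lemma up_chain: "Suc n \<le> p \<Longrightarrow> up (Suc n) p (chain n x) = up n p x"
  using up_up[of n "Suc n" p x] by (simp del: chain.simps)

lemma up_isometry:
  assumes "n \<le> p" "x \<in> carrier (Iter n)" "y \<in> carrier (Iter n)"
  shows "iter_dist p (up n p x) (up n p y) = iter_dist n x y"
  using assms
  by (induction rule: dec_induct) (simp_all add: chain_props(2) up_in del: chain.simps iter_dist.simps Iter.simps)

lemma up_pts:
  assumes "n \<le> p"
  shows "up n p (Tpt (Iter n)) = Tpt (Iter p)" "up n p (Lpt (Iter n)) = Lpt (Iter p)"
    "up n p (Rpt (Iter n)) = Rpt (Iter p)"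
  using assms chain_props(1)
  by (induction rule: dec_induct) (simp_all add: point_preserving_def del: chain.simps Iter.simps)

lemma up_iter_tensor:
  "n \<le> p \<Longrightarrow> x \<in> carrier (Iter n) \<Longrightarrow> up (Suc n) (Suc p) (iter_tensor m n x) = iter_tensor m p (up n p x)"
  by (induction rule: dec_induct) (simp_all add: chain_props(3) up_in del: chain.simps Iter.simps)

lemma equiv_chain_equiv: "equiv chain_sum chain_equiv"
proof (rule equivI)
  have "sym ((chain_step \<union> chain_step\<inverse>)\<^sup>*)"
    by (intro sym_rtrancl sym_Un_converse)
  then show "sym chain_equiv"
    unfolding chain_equiv_def sym_def by blast
qed (auto simp: chain_equiv_def refl_on_def trans_def intro: rtrancl_trans)

text \<open>A zigzag of chain steps can be pushed to one later level: a step upwards raises the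
  common level \<open>p\<close> by one, a step downwards keeps it.\<close>

lemma chain_equiv_imp_up:
  assumes "x \<in> carrier (Iter n)" "((n, x), (m, y)) \<in> (chain_step \<union> chain_step\<inverse>)\<^sup>*"
  shows "y \<in> carrier (Iter m) \<and> (\<exists>p. n \<le> p \<and> m \<le> p \<and> up n p x = up m p y)"
  using assms(2)
proof (induction rule: rtrancl_induct2)
  case refl
  then show ?case using assms(1) by blast
next
  case (step m y k z)
  then obtain p where p: "y \<in> carrier (Iter m)" "n \<le> p" "m \<le> p" "up n p x = up m p y"
    by blast
  have "k = Suc m \<and> z = chain m y \<or> m = Suc k \<and> y = chain k z \<and> z \<in> carrier (Iter k)"
    using step.hyps(2) by (auto simp: chain_step_def)
  then show ?case
  proof (elim disjE conjE)
    assume "k = Suc m" "z = chain m y"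
    moreover have "up n (Suc p) x = up (Suc m) (Suc p) (chain m y)"
      using p up_chain[of m "Suc p" y] by simp
    ultimately show ?thesis
      using p chain_in by (metis Suc_le_mono le_SucI)
  next
    assume "m = Suc k" "y = chain k z" "z \<in> carrier (Iter k)"
    then show ?thesis
      using p up_chain[of k p z] by (auto intro!: exI[of _ p])
  qed
qed

lemma colim_class_chain:
  "x \<in> carrier (Iter n) \<Longrightarrow> colim_class (Suc n) (chain n x) = colim_class n x"
  unfolding colim_class_def
  by (intro equiv_class_eq[OF equiv_chain_equiv])
    (auto simp: chain_equiv_def chain_sum_def chain_step_def chain_in simp del: chain.simps Iter.simps)

lemma colim_class_up:
  "n \<le> p \<Longrightarrow> x \<in> carrier (Iter n) \<Longrightarrow> colim_class p (up n p x) = colim_class n x"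
  by (induction rule: dec_induct) (simp_all add: colim_class_chain up_in del: chain.simps)

lemma in_colim_class_iff:
  assumes "x \<in> carrier (Iter n)"
  shows "(m, y) \<in> colim_class n x \<longleftrightarrow>
    y \<in> carrier (Iter m) \<and> (\<exists>p. n \<le> p \<and> m \<le> p \<and> up n p x = up m p y)" (is "_ \<longleftrightarrow> ?R")
proof
  assume "(m, y) \<in> colim_class n x"
  then show ?R
    using chain_equiv_imp_up[OF assms] by (auto simp: colim_class_def chain_equiv_def)
next
  assume R: ?R
  then have "colim_class n x = colim_class m y"
    using assms colim_class_up by metis
  then show "(m, y) \<in> colim_class n x"
    using R unfolding colim_class_def
    by (auto simp: chain_sum_def intro!: equiv_class_self[OF equiv_chain_equiv])
qed

lemma colim_class_in: "x \<in> carrier (Iter n) \<Longrightarrow> colim_class n x \<in> carrier G"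
  by (auto simp: G_def colim_class_def chain_sum_def intro: quotientI)

lemma G_cases:
  assumes "u \<in> carrier G"
  obtains n x where "x \<in> carrier (Iter n)" "u = colim_class n x"
  using assms by (auto simp: G_def colim_class_def chain_sum_def elim!: quotientE)

text \<open>Reduces the metric axioms of \<open>G\<close>, which involve at most three points, to
  those of one level.\<close>

lemma G_common_level:
  assumes "finite U" "U \<subseteq> carrier G"
  obtains p where "U \<subseteq> colim_class p ` carrier (Iter p)"
proof -
  have "\<exists>p. U \<subseteq> colim_class p ` carrier (Iter p)"
    using assms
  proof (induction rule: finite_induct)
    case (insert u U)
    then obtain p n x where p: "U \<subseteq> colim_class p ` carrier (Iter p)"
      and x: "x \<in> carrier (Iter n)" "u = colim_class n x"
      by (auto elim: G_cases)
    have lift: "colim_class k y \<in> colim_class q ` carrier (Iter q)"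
      if "k \<le> q" "y \<in> carrier (Iter k)" for k q y
      using colim_class_up[OF that] up_in[OF that] by (metis imageI)
    have "insert u U \<subseteq> colim_class (max n p) ` carrier (Iter (max n p))"
      using p x lift[of n "max n p"] lift[of p "max n p"] by auto
    then show ?case ..
  qed simp
  then show ?thesis using that by blast
qed

text \<open>Different representatives of a point coincide at a later level, and the chain maps are
  isometric, so the value does not depend on the level.\<close>

lemma G_dist_colim_class:
  assumes x: "x \<in> carrier (Iter p)" and y: "y \<in> carrier (Iter p)"
  shows "G_dist (colim_class p x) (colim_class p y) = iter_dist p x y"
proof -
  have eq: "iter_dist q x' y' = iter_dist p x y"
    if xy': "(q, x') \<in> colim_class p x" "(q, y') \<in> colim_class p y" for q x' y'
  proof -
    obtain r s where in': "x' \<in> carrier (Iter q)" "y' \<in> carrier (Iter q)"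
      and r: "p \<le> r" "q \<le> r" "up p r x = up q r x'" and s: "p \<le> s" "q \<le> s" "up p s y = up q s y'"
      using xy' x y by (auto simp: in_colim_class_iff)
    let ?t = "max r s"
    have "up p ?t x = up q ?t x'" "up p ?t y = up q ?t y'"
      using r s up_up by (metis max.cobounded1, metis max.cobounded2)
    then have "iter_dist ?t (up p ?t x) (up p ?t y) = iter_dist ?t (up q ?t x') (up q ?t y')"
      by simp
    then show ?thesis
      using r s up_isometry[of p ?t x y] up_isometry[of q ?t x' y'] x y in' by simp
  qed
  have "(p, x) \<in> colim_class p x" "(p, y) \<in> colim_class p y"
    using x y by (auto simp: in_colim_class_iff)
  then have "(THE r. \<exists>q x' y'. (q, x') \<in> colim_class p x \<and> (q, y') \<in> colim_class p y \<and>
      r = iter_dist q x' y') = iter_dist p x y"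
    using eq by (intro the_equality) blast+
  then show ?thesis
    using x y by (simp add: G_dist_def colim_class_in)
qed

text \<open>An isometry separates points, so the colimit identifies no two points of one
  level.\<close>

lemma colim_class_eq_iff:
  "x \<in> carrier (Iter p) \<Longrightarrow> y \<in> carrier (Iter p) \<Longrightarrow> colim_class p x = colim_class p y \<longleftrightarrow> x = y"
  using Iter.zero G_dist_colim_class by metis

lemma G_pts:
  "Tpt G = colim_class n (Tpt (Iter n))" "Lpt G = colim_class n (Lpt (Iter n))"
  "Rpt G = colim_class n (Rpt (Iter n))"
  using colim_class_up[of 0 n, symmetric] Iter.pts[of 0] up_pts[of 0 n]
  by (simp_all add: G_def)

lemma point_preserving_colim_class: "point_preserving (Iter n) G (colim_class n)"
  by (auto simp: point_preserving_def G_pts[of n] colim_class_in)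

lemma tripointed_metric_G: "tripointed_metric G G_dist"
proof
  fix u v w
  assume "u \<in> carrier G" "v \<in> carrier G" "w \<in> carrier G"
  then obtain p where "{u, v, w} \<subseteq> colim_class p ` carrier (Iter p)"
    using G_common_level[of "{u, v, w}"] by auto
  then show "G_dist u w \<le> G_dist u v + G_dist v w"
    using Iter.triangle by (auto simp: G_dist_colim_class)
next
  fix u v
  assume "u \<in> carrier G" "v \<in> carrier G"
  then obtain p where "{u, v} \<subseteq> colim_class p ` carrier (Iter p)"
    using G_common_level[of "{u, v}"] by auto
  then obtain x y where "x \<in> carrier (Iter p)" "y \<in> carrier (Iter p)"
    "u = colim_class p x" "v = colim_class p y"
    by auto
  then show "G_dist u v = 0 \<longleftrightarrow> u = v" "G_dist u v = G_dist v u" "G_dist u v \<le> 1"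
    using Iter.zero Iter.sym Iter.le_one by (auto simp: G_dist_colim_class colim_class_eq_iff)
next
  show "tripointed_set G"
    unfolding tripointed_set_def G_pts[of 0]
    by (simp add: colim_class_eq_iff colim_class_in del: Iter.simps)
qed (use Iter.corners[of 0] Iter.pts[of 0] in \<open>simp_all only: G_pts[of 0] G_dist_colim_class\<close>)

interpretation G: tripointed_metric G G_dist
  by (rule tripointed_metric_G)

section \<open>The algebra map on \<open>G\<close>\<close>

definition G_cons :: "M \<Rightarrow> gpt \<Rightarrow> gpt" where
  "G_cons m u = G_alg (m \<otimes>\<^bsub>G\<^esub> u)"

text \<open>On representatives \<open>G_cons m\<close> prefixes the letter \<open>m\<close>. The
  inner union in \<open>G_alg\<close> is constant because prefixing commutes with the chain maps,
  the outer one by \<open>UN_tensor\<close>.\<close>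

lemma G_cons_colim_class:
  assumes x: "x \<in> carrier (Iter n)"
  shows "G_cons m (colim_class n x) = colim_class (Suc n) (iter_tensor m n x)"
proof -
  define h where "h m u = (\<Union>(n, x)\<in>u. colim_class (Suc n) (iter_tensor m n x))" for m and u :: gpt
  have h: "h m (colim_class n x) = colim_class (Suc n) (iter_tensor m n x)"
    if x: "x \<in> carrier (Iter n)" for m n x
  proof -
    have "colim_class (Suc k) (iter_tensor m k y) = colim_class (Suc n) (iter_tensor m n x)"
      if y: "(k, y) \<in> colim_class n x" for k y
    proof -
      obtain p where p: "y \<in> carrier (Iter k)" "n \<le> p" "k \<le> p" "up n p x = up k p y"
        using y in_colim_class_iff[OF x] by blast
      then have "up (Suc n) (Suc p) (iter_tensor m n x) = up (Suc k) (Suc p) (iter_tensor m k y)"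
        by (simp only: up_iter_tensor x)
      then show ?thesis
        using p x colim_class_up iter_tensor_in by (metis Suc_le_mono)
    qed
    moreover have "(n, x) \<in> colim_class n x"
      using x by (auto simp: in_colim_class_iff)
    ultimately show ?thesis
      unfolding h_def by blast
  qed
  have "(\<Union>(n, u)\<in>m \<otimes>\<^bsub>G\<^esub> colim_class n x. h n u) = h m (colim_class n x)"
    using x iter_tensor_glue[of 0]
    by (intro UN_tensor) (simp_all only: G.tripointed colim_class_in G_pts[of 0] h Iter.pts)
  then show ?thesis
    using x by (simp add: G_cons_def G_alg_def h_def[symmetric] h tensor_in_F_obj colim_class_in)
qed

lemma G_cons_in: "u \<in> carrier G \<Longrightarrow> G_cons m u \<in> carrier G"
  by (elim G_cases) (simp add: G_cons_colim_class colim_class_in iter_tensor_in del: Iter.simps)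

lemma G_cons_dist:
  assumes "u \<in> carrier G" "v \<in> carrier G"
  shows "G_dist (G_cons m u) (G_cons n v) = rep_dist G G_dist (m, u) (n, v)"
proof -
  obtain p where "{u, v} \<subseteq> colim_class p ` carrier (Iter p)"
    using G_common_level[of "{u, v}"] assms by auto
  then obtain x y where "x \<in> carrier (Iter p)" "y \<in> carrier (Iter p)"
    "u = colim_class p x" "v = colim_class p y"
    by auto
  then show ?thesis
    by (simp add: G_cons_colim_class G_dist_colim_class iter_tensor_in iter_dist_tensor
      Iter.rep_dist_isometry[OF point_preserving_colim_class] del: Iter.simps iter_dist.simps)
qed

text \<open>This is surjectivity of \<open>g\<close>. The representative is first moved up one
  level, since at level 0 it has no first letter.\<close>

lemma G_cons_cases:
  assumes "u \<in> carrier G"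
  obtains m v where "v \<in> carrier G" "u = G_cons m v"
proof -
  obtain n x where x: "x \<in> carrier (Iter n)" "u = colim_class n x"
    using assms by (rule G_cases)
  obtain m y where y: "y \<in> carrier (Iter n)" "chain n x = iter_tensor m n y"
    using Iter_Suc_cases[OF chain_in[OF x(1)]] .
  then have "u = G_cons m (colim_class n y)"
    using x colim_class_chain[OF x(1)] by (simp add: G_cons_colim_class)
  then show ?thesis
    using that colim_class_in[OF y(1)] by blast
qed

lemma G_cons_glue:
  "G_cons Mb (Tpt G) = G_cons Ma (Lpt G)" "G_cons Ma (Rpt G) = G_cons Mc (Tpt G)"
  "G_cons Mc (Lpt G) = G_cons Mb (Rpt G)"
  by (simp_all add: G_cons_def tensor_glue[OF G.tripointed])

lemma G_cons_pts: "G_cons Ma (Tpt G) = Tpt G" "G_cons Mb (Lpt G) = Lpt G" "G_cons Mc (Rpt G) = Rpt G"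
  using G_pts[of 0] G_pts[of "Suc 0"] Iter_Suc_pts[of 0] Iter.pts[of 0] G_cons_colim_class[of _ 0]
  by metis+

section \<open>Words and the approximating sequences\<close>

lemma word_tensor_in: "word_tensor w p \<in> carrier (Iter (length w))"
  by (induction w) (auto simp: iter_tensor_in simp del: Iter.simps(2))

text \<open>This includes \<open>k = 0\<close>: the final letter \<open>m 1\<close>, which determines the base point on the
  left, is the value of the shifted sequence at \<open>0\<close>.\<close>

lemma theta_Suc: "theta m (Suc k) = G_cons (m 1) (theta (\<lambda>i. m (Suc i)) k)"
proof -
  have "map m [1..<Suc (Suc k)] = m 1 # map (\<lambda>i. m (Suc i)) [1..<Suc k]"
    by (simp add: upt_conv_Cons map_Suc_upt[symmetric] del: upt_Suc)
  then show ?thesis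
    using G_cons_colim_class[OF word_tensor_in, of "m 1" "map (\<lambda>i. m (Suc i)) [1..<Suc k]"]
    by (simp add: theta_def del: upt_Suc)
qed

lemma theta_in: "theta m k \<in> carrier G"
  using colim_class_in[OF word_tensor_in[of "map m [1..<Suc k]" "corner_pt (m k)"]]
  by (simp add: theta_def del: upt_Suc)

section \<open>The completion\<close>

lemma (in tripointed_metric) Metric_space:
  assumes "\<And>x y. 0 \<le> d x y" "\<And>x y. d x y = d y x"
  shows "Metric_space (carrier X) d"
  using assms zero triangle by unfold_locales auto

section \<open>The completion of an arbitrary metric space\<close>

context Metric_space
begin

lemma dist_diff:
  assumes "x \<in> M" "y \<in> M" "x' \<in> M" "y' \<in> M"
  shows "\<bar>d x y - d x' y'\<bar> \<le> d x x' + d y y'"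
  using assms triangle[of x x' y] triangle[of x' y' y] triangle[of x' x y'] triangle[of x y y']
    commute[of x x'] commute[of y y'] by linarith

lemma convergent_dist:
  assumes \<sigma>: "MCauchy \<sigma>" and \<tau>: "MCauchy \<tau>"
  shows "convergent (\<lambda>n. d (\<sigma> n) (\<tau> n))"
proof -
  have in': "\<sigma> n \<in> M" "\<tau> n \<in> M" for n
    using assms by (auto simp: MCauchy_def)
  have "Cauchy (\<lambda>n. d (\<sigma> n) (\<tau> n))"
  proof (rule metric_CauchyI)
    fix e :: real
    assume "0 < e"
    then obtain N1 N2 where "\<And>n k. N1 \<le> n \<Longrightarrow> N1 \<le> k \<Longrightarrow> d (\<sigma> n) (\<sigma> k) < e / 2"
      and "\<And>n k. N2 \<le> n \<Longrightarrow> N2 \<le> k \<Longrightarrow> d (\<tau> n) (\<tau> k) < e / 2"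
      using \<sigma> \<tau> unfolding MCauchy_def by (meson half_gt_zero)
    then have "dist (d (\<sigma> n) (\<tau> n)) (d (\<sigma> k) (\<tau> k)) < e" if "max N1 N2 \<le> n" "max N1 N2 \<le> k" for n k
      using that dist_diff[OF in' in', of n n k k] unfolding dist_real_def
      by (smt (verit) field_sum_of_halves max.bounded_iff)
    then show "\<exists>N. \<forall>n\<ge>N. \<forall>k\<ge>N. dist (d (\<sigma> n) (\<tau> n)) (d (\<sigma> k) (\<tau> k)) < e"
      by blast
  qed
  then show ?thesis
    by (rule Cauchy_convergent)
qed

text \<open>By \<open>dist_diff\<close> the two distance sequences differ by a null sequence. This
  serves both transitivity of \<open>cauchy_equiv\<close> and independence of
  \<open>completion_dist\<close> from representatives.\<close>

lemma dist_tendsto_cong: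
  assumes in': "range \<sigma> \<subseteq> M" "range \<tau> \<subseteq> M" "range \<sigma>' \<subseteq> M" "range \<tau>' \<subseteq> M"
    and "(\<lambda>n. d (\<sigma> n) (\<sigma>' n)) \<longlonglongrightarrow> 0" "(\<lambda>n. d (\<tau> n) (\<tau>' n)) \<longlonglongrightarrow> 0"
    and lim: "(\<lambda>n. d (\<sigma> n) (\<tau> n)) \<longlonglongrightarrow> r"
  shows "(\<lambda>n. d (\<sigma>' n) (\<tau>' n)) \<longlonglongrightarrow> r"
proof -
  have "(\<lambda>n. d (\<sigma> n) (\<sigma>' n) + d (\<tau> n) (\<tau>' n)) \<longlonglongrightarrow> 0"
    using tendsto_add[OF assms(5,6)] by simp
  then have "(\<lambda>n. d (\<sigma> n) (\<tau> n) - d (\<sigma>' n) (\<tau>' n)) \<longlonglongrightarrow> 0"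
    using in' by (elim Lim_null_comparison[rotated]) (intro always_eventually allI, simp, intro dist_diff, auto)
  from tendsto_diff[OF lim this] show ?thesis
    by simp
qed

lemma equiv_cauchy_equiv: "equiv (cauchy_seqs M d) (cauchy_equiv M d)"
proof (rule equivI)
  show "trans (cauchy_equiv M d)"
  proof (rule transI)
    fix \<sigma> \<tau> \<rho>
    assume "(\<sigma>, \<tau>) \<in> cauchy_equiv M d" "(\<tau>, \<rho>) \<in> cauchy_equiv M d"
    then show "(\<sigma>, \<rho>) \<in> cauchy_equiv M d"
      using dist_tendsto_cong[of \<sigma> \<tau> \<sigma> \<rho> 0]
      by (auto simp: cauchy_equiv_def cauchy_seqs_def MCauchy_def image_subset_iff)
  qed
qed (auto simp: cauchy_equiv_def cauchy_seqs_def refl_on_def sym_def commute MCauchy_def image_subset_iff)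

lemma completion_class_eq_iff:
  assumes "MCauchy \<sigma>" "MCauchy \<tau>"
  shows "completion_class M d \<sigma> = completion_class M d \<tau> \<longleftrightarrow> (\<lambda>n. d (\<sigma> n) (\<tau> n)) \<longlonglongrightarrow> 0"
  using assms eq_equiv_class_iff[OF equiv_cauchy_equiv, of \<sigma> \<tau>]
  by (simp add: completion_class_def cauchy_equiv_def cauchy_seqs_def)

lemma completion_class_in: "MCauchy \<sigma> \<Longrightarrow> completion_class M d \<sigma> \<in> completion M d"
  by (auto simp: completion_def completion_class_def cauchy_seqs_def intro: quotientI)

lemma completion_cases:
  assumes "P \<in> completion M d"
  obtains \<sigma> where "MCauchy \<sigma>" "P = completion_class M d \<sigma>"
  using assms by (auto simp: completion_def completion_class_def cauchy_seqs_def elim!: quotientE)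

lemma completion_dist_tendsto:
  assumes \<sigma>: "MCauchy \<sigma>" and \<tau>: "MCauchy \<tau>"
  shows "(\<lambda>n. d (\<sigma> n) (\<tau> n)) \<longlonglongrightarrow>
    completion_dist M d (completion_class M d \<sigma>) (completion_class M d \<tau>)"
proof -
  let ?P = "completion_class M d \<sigma>" and ?Q = "completion_class M d \<tau>"
  obtain r where r: "(\<lambda>n. d (\<sigma> n) (\<tau> n)) \<longlonglongrightarrow> r"
    using convergent_dist[OF assms] by (auto simp: convergent_def)
  have lim: "(\<lambda>n. d (\<sigma>' n) (\<tau>' n)) \<longlonglongrightarrow> r" if "\<sigma>' \<in> ?P" "\<tau>' \<in> ?Q" for \<sigma>' \<tau>'
    using that assms r dist_tendsto_cong[of \<sigma> \<tau> \<sigma>' \<tau>' r]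
    by (auto simp: completion_class_def cauchy_equiv_def cauchy_seqs_def MCauchy_def)
  have "\<sigma> \<in> ?P" "\<tau> \<in> ?Q"
    using assms
    by (auto simp: completion_class_def cauchy_equiv_def cauchy_seqs_def MCauchy_def image_subset_iff)
  then have "(THE r. \<exists>\<sigma>\<in>?P. \<exists>\<tau>\<in>?Q. (\<lambda>n. d (\<sigma> n) (\<tau> n)) \<longlonglongrightarrow> r) = r"
    using lim LIMSEQ_unique by (intro the_equality) blast+
  then show ?thesis
    using assms r by (simp add: completion_dist_def completion_class_in)
qed

lemma Metric_space_completion: "Metric_space (completion M d) (completion_dist M d)"
proof
  fix P Q
  \<comment> \<open>Nonnegativity and symmetry are required for all arguments; off the completion
    they hold because the value there is 0.\<close>
  show "0 \<le> completion_dist M d P Q"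
  proof (cases "P \<in> completion M d \<and> Q \<in> completion M d")
    case True
    then show ?thesis
      by (elim conjE completion_cases) (auto intro: LIMSEQ_le_const[OF completion_dist_tendsto])
  qed (auto simp: completion_dist_def)
  show "completion_dist M d P Q = completion_dist M d Q P"
  proof (cases "P \<in> completion M d \<and> Q \<in> completion M d")
    case True
    then obtain \<sigma> \<tau> where "MCauchy \<sigma>" "P = completion_class M d \<sigma>" "MCauchy \<tau>" "Q = completion_class M d \<tau>"
      by (meson completion_cases)
    then show ?thesis
      using completion_dist_tendsto[of \<sigma> \<tau>] completion_dist_tendsto[of \<tau> \<sigma>]
      by (simp add: commute LIMSEQ_unique)
  qed (auto simp: completion_dist_def)
next
  fix P Q
  assume "P \<in> completion M d" "Q \<in> completion M d"
  then obtain \<sigma> \<tau> where "MCauchy \<sigma>" "P = completion_class M d \<sigma>" "MCauchy \<tau>" "Q = completion_class M d \<tau>"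
    by (meson completion_cases)
  then show "completion_dist M d P Q = 0 \<longleftrightarrow> P = Q"
    using completion_dist_tendsto[of \<sigma> \<tau>] LIMSEQ_unique by (auto simp: completion_class_eq_iff)
next
  fix P Q R
  assume "P \<in> completion M d" "Q \<in> completion M d" "R \<in> completion M d"
  then obtain \<sigma> \<tau> \<rho> where *: "MCauchy \<sigma>" "P = completion_class M d \<sigma>" "MCauchy \<tau>" "Q = completion_class M d \<tau>"
    "MCauchy \<rho>" "R = completion_class M d \<rho>"
    by (meson completion_cases)
  then have "d (\<sigma> n) (\<rho> n) \<le> d (\<sigma> n) (\<tau> n) + d (\<tau> n) (\<rho> n)" for n
    by (intro triangle) (auto simp: MCauchy_def)
  moreover have "(\<lambda>n. d (\<sigma> n) (\<tau> n) + d (\<tau> n) (\<rho> n)) \<longlonglongrightarrow> completion_dist M d P Q + completion_dist M d Q R"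
    "(\<lambda>n. d (\<sigma> n) (\<rho> n)) \<longlonglongrightarrow> completion_dist M d P R"
    unfolding * using *(1,3,5) by (intro tendsto_add completion_dist_tendsto; simp)+
  ultimately show "completion_dist M d P R \<le> completion_dist M d P Q + completion_dist M d Q R"
    by (intro LIMSEQ_le) auto
qed

end

section \<open>\<open>S\<close> as a tri-pointed metric space\<close>

interpretation GM: Metric_space "carrier G" G_dist
proof (rule G.Metric_space)
  fix u v
  have "0 \<le> G_dist u v \<and> G_dist u v = G_dist v u" if "u \<in> carrier G" "v \<in> carrier G"
    using that G.nonneg G.sym by simp
  moreover have "G_dist u v = 0 \<and> G_dist v u = 0" if "\<not> (u \<in> carrier G \<and> v \<in> carrier G)"
    using that by (auto simp: G_dist_def)
  ultimately show "0 \<le> G_dist u v" "G_dist u v = G_dist v u"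
    by fastforce+
qed

lemma carrier_S: "carrier S = completion (carrier G) G_dist"
  by (simp add: S_def)

interpretation SM: Metric_space "carrier S" S_dist
  unfolding carrier_S S_dist_def by (rule GM.Metric_space_completion)

lemma S_embed_eq: "S_embed u = S_class (\<lambda>_. u)"
  by (simp add: S_embed_def completion_embed_def S_class_def)

lemma S_pts: "Tpt S = S_embed (Tpt G)" "Lpt S = S_embed (Lpt G)" "Rpt S = S_embed (Rpt G)"
  by (simp_all add: S_def)

lemma S_class_in: "GM.MCauchy \<sigma> \<Longrightarrow> S_class \<sigma> \<in> carrier S"
  by (simp add: S_class_def carrier_S GM.completion_class_in)

lemma S_cases:
  assumes "P \<in> carrier S"
  obtains \<sigma> where "GM.MCauchy \<sigma>" "P = S_class \<sigma>"
  using assms by (auto simp: S_class_def carrier_S elim: GM.completion_cases)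

lemma S_class_eq_iff:
  "GM.MCauchy \<sigma> \<Longrightarrow> GM.MCauchy \<tau> \<Longrightarrow> S_class \<sigma> = S_class \<tau> \<longleftrightarrow> (\<lambda>n. G_dist (\<sigma> n) (\<tau> n)) \<longlonglongrightarrow> 0"
  by (simp add: S_class_def GM.completion_class_eq_iff)

lemma S_dist_tendsto:
  "GM.MCauchy \<sigma> \<Longrightarrow> GM.MCauchy \<tau> \<Longrightarrow>
    (\<lambda>n. G_dist (\<sigma> n) (\<tau> n)) \<longlonglongrightarrow> S_dist (S_class \<sigma>) (S_class \<tau>)"
  by (simp add: S_class_def S_dist_def GM.completion_dist_tendsto)

lemma S_embed_in: "u \<in> carrier G \<Longrightarrow> S_embed u \<in> carrier S"
  by (simp add: S_embed_eq S_class_in)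

lemma S_dist_embed: "u \<in> carrier G \<Longrightarrow> v \<in> carrier G \<Longrightarrow> S_dist (S_embed u) (S_embed v) = G_dist u v"
  using S_dist_tendsto[of "\<lambda>_. u" "\<lambda>_. v"] by (simp add: S_embed_eq LIMSEQ_const_iff)

interpretation S: tripointed_metric S S_dist
proof
  show "S_dist P Q \<le> 1" if PQ: "P \<in> carrier S" "Q \<in> carrier S" for P Q
  proof -
    obtain \<sigma> \<tau> where *: "GM.MCauchy \<sigma>" "P = S_class \<sigma>" "GM.MCauchy \<tau>" "Q = S_class \<tau>"
      using PQ by (meson S_cases)
    then have "G_dist (\<sigma> n) (\<tau> n) \<le> 1" for n
      by (intro G.le_one) (auto simp: GM.MCauchy_def)
    then show ?thesis
      using * S_dist_tendsto[of \<sigma> \<tau>] LIMSEQ_le_const2 by blast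
  qed
  show corners: "S_dist (Tpt S) (Lpt S) = 1" "S_dist (Tpt S) (Rpt S) = 1" "S_dist (Lpt S) (Rpt S) = 1"
    by (simp_all add: S_pts S_dist_embed G.corners)
  have "Tpt S \<in> carrier S" "Lpt S \<in> carrier S" "Rpt S \<in> carrier S"
    by (simp_all add: S_pts S_embed_in)
  then show "tripointed_set S"
    unfolding tripointed_set_def using corners SM.mdist_zero by (metis zero_neq_one)
qed (auto simp: SM.commute SM.triangle)

section \<open>The algebra map on \<open>S\<close>\<close>

definition S_cons :: "M \<Rightarrow> spt \<Rightarrow> spt" where
  "S_cons m P = S_alg (m \<otimes>\<^bsub>S\<^esub> P)"

text \<open>\<open>G_cons m\<close> halves distances, which only rescales the Cauchy condition. The
  direction from left to right allows a common first letter to be removed from a sequence.\<close>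

lemma MCauchy_G_cons_iff:
  assumes "range \<sigma> \<subseteq> carrier G"
  shows "GM.MCauchy (\<lambda>n. G_cons m (\<sigma> n)) \<longleftrightarrow> GM.MCauchy \<sigma>"
proof -
  have half: "G_dist (G_cons m (\<sigma> n)) (G_cons m (\<sigma> k)) = G_dist (\<sigma> n) (\<sigma> k) / 2" for n k
    using assms by (simp add: G_cons_dist G.rep_dist_same image_subset_iff)
  have scale: "(\<forall>e>0. \<exists>N. \<forall>n k. N \<le> n \<longrightarrow> N \<le> k \<longrightarrow> f n k / 2 < e) \<longleftrightarrow>
      (\<forall>e>0. \<exists>N. \<forall>n k. N \<le> n \<longrightarrow> N \<le> k \<longrightarrow> f n k < e)" (is "?L \<longleftrightarrow> ?R")
    for f :: "nat \<Rightarrow> nat \<Rightarrow> real"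
  proof
    show ?R if ?L
    proof (intro allI impI)
      fix e :: real
      assume "e > 0"
      then show "\<exists>N. \<forall>n k. N \<le> n \<longrightarrow> N \<le> k \<longrightarrow> f n k < e"
        using \<open>?L\<close>[rule_format, of "e / 2"] by simp
    qed
    show ?L if ?R
    proof (intro allI impI)
      fix e :: real
      assume "e > 0"
      then show "\<exists>N. \<forall>n k. N \<le> n \<longrightarrow> N \<le> k \<longrightarrow> f n k / 2 < e"
        using \<open>?R\<close>[rule_format, of "2 * e"] by (simp add: field_simps)
    qed
  qed
  show ?thesis
    using assms unfolding GM.MCauchy_def half scale[of "\<lambda>n k. G_dist (\<sigma> n) (\<sigma> k)"]
    by (auto simp: G_cons_in image_subset_iff)
qed

lemma MCauchy_G_cons: "GM.MCauchy \<sigma> \<Longrightarrow> GM.MCauchy (\<lambda>n. G_cons m (\<sigma> n))"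
  using MCauchy_G_cons_iff GM.MCauchy_def by metis

lemma S_cons_class:
  assumes \<sigma>: "GM.MCauchy \<sigma>"
  shows "S_cons m (S_class \<sigma>) = S_class (\<lambda>n. G_cons m (\<sigma> n))"
proof -
  define h where "h m P = (\<Union>\<sigma>\<in>P. S_class (\<lambda>n. G_alg (m \<otimes>\<^bsub>G\<^esub> \<sigma> n)))" for m and P :: spt
  have h: "h m (S_class \<sigma>) = S_class (\<lambda>n. G_cons m (\<sigma> n))" if \<sigma>: "GM.MCauchy \<sigma>" for m \<sigma>
  proof -
    have "S_class (\<lambda>n. G_cons m (\<tau> n)) = S_class (\<lambda>n. G_cons m (\<sigma> n))" if "\<tau> \<in> S_class \<sigma>" for \<tau>
    proof -
      have \<tau>: "GM.MCauchy \<tau>" and lim: "(\<lambda>n. G_dist (\<sigma> n) (\<tau> n)) \<longlonglongrightarrow> 0"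
        using that by (auto simp: S_class_def completion_class_def cauchy_equiv_def cauchy_seqs_def)
      have "G_dist (G_cons m (\<sigma> n)) (G_cons m (\<tau> n)) = G_dist (\<sigma> n) (\<tau> n) / 2" for n
        using \<sigma> \<tau> by (simp add: G_cons_dist G.rep_dist_same GM.MCauchy_def image_subset_iff)
      then have "(\<lambda>n. G_dist (G_cons m (\<sigma> n)) (G_cons m (\<tau> n))) \<longlonglongrightarrow> 0"
        using tendsto_divide_zero[OF lim, of 2] by (simp only:)
      then show ?thesis
        using \<sigma> \<tau> S_class_eq_iff MCauchy_G_cons by metis
    qed
    moreover have "\<sigma> \<in> S_class \<sigma>"
      using \<sigma> by (auto simp: S_class_def completion_class_def cauchy_equiv_def cauchy_seqs_def
          GM.MCauchy_def image_subset_iff)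
    ultimately show ?thesis
      unfolding h_def G_cons_def[symmetric] by blast
  qed
  \<comment> \<open>The distinguished points of \<open>S\<close> are classes of constant sequences,
    so the gluing equations hold termwise by \<open>G_cons_glue\<close>.\<close>
  have "(\<Union>(n, P)\<in>m \<otimes>\<^bsub>S\<^esub> S_class \<sigma>. h n P) = h m (S_class \<sigma>)"
    using \<sigma> by (intro UN_tensor) (simp_all add: S.tripointed S_class_in S_pts S_embed_eq h G_cons_glue)
  then show ?thesis
    using \<sigma> by (simp add: S_cons_def S_alg_def h_def[symmetric] h tensor_in_F_obj S_class_in)
qed

lemma S_cons_in: "P \<in> carrier S \<Longrightarrow> S_cons m P \<in> carrier S"
  by (elim S_cases) (simp add: S_cons_class S_class_in MCauchy_G_cons)

lemma S_cons_embed: "u \<in> carrier G \<Longrightarrow> S_cons m (S_embed u) = S_embed (G_cons m u)"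
  by (simp add: S_embed_eq S_cons_class)

text \<open>\<open>rep_dist\<close> is built from distances by continuous operations, so
  \<open>G_cons_dist\<close> passes to the limit along representing sequences.\<close>

lemma S_cons_dist:
  assumes "P \<in> carrier S" "Q \<in> carrier S"
  shows "S_dist (S_cons m P) (S_cons n Q) = rep_dist S S_dist (m, P) (n, Q)"
proof -
  obtain \<sigma> \<tau> where \<sigma>: "GM.MCauchy \<sigma>" "P = S_class \<sigma>" and \<tau>: "GM.MCauchy \<tau>" "Q = S_class \<tau>"
    using assms by (meson S_cases)
  have "(\<lambda>k. rep_dist G G_dist (m, \<sigma> k) (n, \<tau> k)) \<longlonglongrightarrow> rep_dist S S_dist (m, P) (n, Q)"
    using \<sigma> \<tau> by (cases m; cases n)
      (auto simp: S_pts S_embed_eq intro!: tendsto_intros tendsto_min S_dist_tendsto)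
  moreover have "G_dist (G_cons m (\<sigma> k)) (G_cons n (\<tau> k)) = rep_dist G G_dist (m, \<sigma> k) (n, \<tau> k)" for k
    using \<sigma>(1) \<tau>(1) by (simp add: G_cons_dist GM.MCauchy_def image_subset_iff)
  moreover have "(\<lambda>k. G_dist (G_cons m (\<sigma> k)) (G_cons n (\<tau> k))) \<longlonglongrightarrow> S_dist (S_cons m P) (S_cons n Q)"
    using \<sigma> \<tau> by (simp add: S_cons_class S_dist_tendsto MCauchy_G_cons)
  ultimately show ?thesis
    using LIMSEQ_unique by auto
qed

text \<open>As \<open>n \<le> r n\<close>, the Cauchy condition compares the two sequences. Used for
  subsequences within one copy of \<open>G\<close> and, with \<open>r = Suc\<close>, for dropping
  the first term.\<close>

lemma S_class_subseq:
  assumes "GM.MCauchy \<sigma>" "strict_mono r"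
  shows "S_class (\<sigma> \<circ> r) = S_class \<sigma>"
proof -
  have "(\<lambda>n. G_dist (\<sigma> (r n)) (\<sigma> n)) \<longlonglongrightarrow> 0"
  proof (rule LIMSEQ_I)
    fix e :: real
    assume "e > 0"
    then obtain N where N: "\<And>n k. N \<le> n \<Longrightarrow> N \<le> k \<Longrightarrow> G_dist (\<sigma> n) (\<sigma> k) < e"
      using assms(1) unfolding GM.MCauchy_def by blast
    have "G_dist (\<sigma> (r n)) (\<sigma> n) < e" if "N \<le> n" for n
      using that N[of "r n" n] seq_suble[OF assms(2), of n] by simp
    then show "\<exists>N. \<forall>n\<ge>N. norm (G_dist (\<sigma> (r n)) (\<sigma> n) - 0) < e"
      by auto
  qed
  then show ?thesis
    using assms GM.MCauchy_subsequence by (auto simp: S_class_eq_iff)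
qed

text \<open>Infinitely many terms of a Cauchy sequence in \<open>G\<close> lie in the same copy of \<open>G\<close>.\<close>

lemma S_cons_cases:
  assumes "P \<in> carrier S"
  obtains m Q where "Q \<in> carrier S" "P = S_cons m Q"
proof -
  obtain \<sigma> where \<sigma>: "GM.MCauchy \<sigma>" "P = S_class \<sigma>"
    using assms by (rule S_cases)
  have "\<exists>m v. v \<in> carrier G \<and> \<sigma> n = G_cons m v" for n
  proof -
    have "\<sigma> n \<in> carrier G"
      using \<sigma>(1) by (auto simp: GM.MCauchy_def)
    then show ?thesis
      using G_cons_cases by metis
  qed
  then obtain \<mu> \<nu> where \<nu>: "\<And>n. \<nu> n \<in> carrier G" and eq: "\<And>n. \<sigma> n = G_cons (\<mu> n) (\<nu> n)"
    by metis
  have "UNIV = {Ma, Mb, Mc}"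
    using M.exhaust by blast
  then have "finite (range \<mu>)"
    by (metis finite.emptyI finite.insertI finite_subset top_greatest)
  then obtain k where "infinite {n. \<mu> n = \<mu> k}"
    using pigeonhole_infinite[of UNIV \<mu>] by auto
  then obtain r :: "nat \<Rightarrow> nat" where r: "strict_mono r" "\<And>n. \<mu> (r n) = \<mu> k"
    using infinite_enumerate[of "{n. \<mu> n = \<mu> k}"] by auto
  have "\<sigma> \<circ> r = (\<lambda>n. G_cons (\<mu> k) (\<nu> (r n)))"
    by (auto simp: eq r(2))
  moreover from this have "GM.MCauchy (\<lambda>n. \<nu> (r n))"
    using GM.MCauchy_subsequence[OF r(1) \<sigma>(1)] MCauchy_G_cons_iff[of "\<lambda>n. \<nu> (r n)"] \<nu> by auto
  ultimately have "P = S_cons (\<mu> k) (S_class (\<lambda>n. \<nu> (r n)))" "S_class (\<lambda>n. \<nu> (r n)) \<in> carrier S"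
    using \<sigma> S_class_subseq[OF \<sigma>(1) r(1)] by (simp_all add: S_cons_class S_class_in)
  then show ?thesis
    using that by blast
qed

lemma S_cons_pts: "S_cons Ma (Tpt S) = Tpt S" "S_cons Mb (Lpt S) = Lpt S" "S_cons Mc (Rpt S) = Rpt S"
  by (simp_all add: S_pts S_cons_embed G_cons_pts)

text \<open>Injectivity follows from the isometry: equal images have distance 0, and representatives
  at distance 0 are glued. Surjectivity is \<open>S_cons_cases\<close>.\<close>

lemma S_alg_bij: "bij_betw S_alg (carrier (F_obj S)) (carrier S)"
proof -
  have "inj_on S_alg (carrier (F_obj S))"
  proof (rule inj_onI)
    fix z w
    assume zw: "z \<in> carrier (F_obj S)" "w \<in> carrier (F_obj S)" "S_alg z = S_alg w"
    then obtain m P n Q where *: "P \<in> carrier S" "Q \<in> carrier S" "z = m \<otimes>\<^bsub>S\<^esub> P" "w = n \<otimes>\<^bsub>S\<^esub> Q"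
      by (metis F_obj_cases)
    then have "S_dist (S_cons m P) (S_cons n Q) = 0"
      using zw S_cons_in by (simp add: S_cons_def[symmetric])
    then show "z = w"
      using * by (simp add: S_cons_dist S.rep_dist_zero tensor_eq_iff)
  qed
  moreover have "S_alg ` carrier (F_obj S) = carrier S"
  proof
    show "S_alg ` carrier (F_obj S) \<subseteq> carrier S"
      using S_cons_in by (auto simp: S_cons_def elim!: F_obj_cases)
    show "carrier S \<subseteq> S_alg ` carrier (F_obj S)"
    proof
      fix P
      assume "P \<in> carrier S"
      then obtain m Q where "Q \<in> carrier S" "P = S_alg (m \<otimes>\<^bsub>S\<^esub> Q)"
        unfolding S_cons_def[symmetric] by (rule S_cons_cases)
      then show "P \<in> S_alg ` carrier (F_obj S)"
        using tensor_in_F_obj by blast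
    qed
  qed
  ultimately show ?thesis
    by (simp add: bij_betw_def)
qed

section \<open>The inverse of the algebra map as a coalgebra\<close>

lemma S_coalg_cons: "P \<in> carrier S \<Longrightarrow> S_coalg (S_cons m P) = m \<otimes>\<^bsub>S\<^esub> P"
  using S_cons_in[of P m] S_alg_bij
  by (simp add: S_coalg_def S_cons_def bij_betw_inv_into_left tensor_in_F_obj)

lemma S_alg_S_coalg: "P \<in> carrier S \<Longrightarrow> S_alg (S_coalg P) = P"
  using S_alg_bij by (simp add: S_coalg_def bij_betw_inv_into_right)

lemma coalgebra_S: "coalgebra S S_coalg"
proof -
  have "S_coalg P \<in> carrier (F_obj S)" if "P \<in> carrier S" for P
    using S_cons_cases[OF that] S_coalg_cons tensor_in_F_obj by metis
  \<comment> \<open>Each distinguished point is fixed by the contraction of its own letter, so its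
    preimage under \<open>S_alg\<close> is the corresponding corner.\<close>
  moreover have "S_coalg (Tpt S) = Tpt (F_obj S)" "S_coalg (Lpt S) = Lpt (F_obj S)"
    "S_coalg (Rpt S) = Rpt (F_obj S)"
    using S_coalg_cons[of "Tpt S" Ma] S_coalg_cons[of "Lpt S" Mb] S_coalg_cons[of "Rpt S" Mc]
    by (simp_all add: S_cons_pts F_obj_def)
  ultimately show ?thesis
    by (auto simp: coalgebra_def S.tripointed morphism_iff point_preserving_def S_coalg_def)
qed

section \<open>Morphisms into the completion\<close>

lemma coalgebra_steps:
  assumes "coalgebra X e"
  obtains \<mu> \<nu> where "\<And>x. x \<in> carrier X \<Longrightarrow> \<nu> x \<in> carrier X \<and> e x = \<mu> x \<otimes>\<^bsub>X\<^esub> \<nu> x"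
proof -
  have "\<exists>m y. y \<in> carrier X \<and> e x = m \<otimes>\<^bsub>X\<^esub> y" if "x \<in> carrier X" for x
  proof -
    have "e x \<in> carrier (F_obj X)"
      using assms that by (auto simp: coalgebra_def morphism_iff point_preserving_def)
    then show ?thesis
      by (rule F_obj_cases) blast
  qed
  then show ?thesis
    using that by metis
qed

text \<open>Applying \<open>S_alg\<close> turns the morphism equation into an equation in
  \<open>S\<close>, valid for every representation of \<open>e x\<close>.\<close>

lemma coalgebra_morphismD:
  assumes "coalgebra X e" "coalgebra_morphism X e S S_coalg f"
    and "x \<in> carrier X" "y \<in> carrier X" "e x = m \<otimes>\<^bsub>X\<^esub> y"
  shows "f x = S_cons m (f y)"
proof -
  have f: "point_preserving X S f" and "tripointed_set X"
    using assms by (auto simp: coalgebra_morphism_def morphism_iff coalgebra_def)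
  then have "S_coalg (f x) = m \<otimes>\<^bsub>S\<^esub> f y"
    using assms F_map_tensor[OF _ S.tripointed f] by (metis coalgebra_morphism_def)
  moreover have "f x \<in> carrier S"
    using f assms(3) by (auto simp: point_preserving_def)
  ultimately show ?thesis
    using S_alg_S_coalg by (metis S_cons_def)
qed

text \<open>Conversely, one representation at each point is enough, since it already determines the
  value of \<open>F_map\<close> at \<open>e x\<close>.\<close>

lemma coalgebra_morphismI:
  assumes X: "coalgebra X e" and f: "morphism X S f"
    and step: "\<And>x. x \<in> carrier X \<Longrightarrow> \<exists>m. \<exists>y\<in>carrier X. e x = m \<otimes>\<^bsub>X\<^esub> y \<and> f x = S_cons m (f y)"
  shows "coalgebra_morphism X e S S_coalg f"
proof -
  have pp: "point_preserving X S f" and "tripointed_set X"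
    using X f by (auto simp: morphism_iff coalgebra_def)
  have "F_map X S f (e x) = S_coalg (f x)" if x: "x \<in> carrier X" for x
  proof -
    obtain m y where y: "y \<in> carrier X" "e x = m \<otimes>\<^bsub>X\<^esub> y" "f x = S_cons m (f y)"
      using step[OF x] by blast
    then have "f y \<in> carrier S"
      using pp by (auto simp: point_preserving_def)
    then show ?thesis
      using y F_map_tensor[OF \<open>tripointed_set X\<close> S.tripointed pp y(1)] by (simp add: S_coalg_cons)
  qed
  then show ?thesis
    using f by (simp add: coalgebra_morphism_def)
qed

section \<open>The limit formula\<close>

lemma theta_dist_morphism:
  assumes "coalgebra X e" "coalgebra_morphism X e S S_coalg f"
    and "x \<in> carrier X" "resolution X e x m xs"
  shows "S_dist (S_embed (theta m k)) (f x) \<le> (1/2) ^ k"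
  using assms(3,4)
\<comment> \<open>The resolution varies, because the induction hypothesis is applied at
  \<open>xs 1\<close> to the resolution with its first step dropped.\<close>
proof (induction k arbitrary: x m xs)
  have f: "f x \<in> carrier S" if "x \<in> carrier X" for x
    using assms(2) that by (auto simp: coalgebra_morphism_def morphism_iff point_preserving_def)
  \<comment> \<open>\<open>theta m 0\<close> depends on the arbitrary letter \<open>m 0\<close>, but
    the bound 1 holds for any two points.\<close>
  case 0
  then show ?case
    using S.le_one f S_embed_in theta_in by simp
  case (Suc k)
  have "xs 0 = x" and r: "\<And>n. 1 \<le> n \<Longrightarrow> xs n \<in> carrier X \<and> e (xs (n - 1)) = m n \<otimes>\<^bsub>X\<^esub> xs n"
    using Suc.prems(2) unfolding resolution_def by simp_all
  then have *: "xs 0 = x" "\<And>n. xs (Suc n) \<in> carrier X" "\<And>n. e (xs n) = m (Suc n) \<otimes>\<^bsub>X\<^esub> xs (Suc n)"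
    using r[of "Suc n" for n] by simp_all
  then have "resolution X e (xs 1) (\<lambda>n. m (Suc n)) (\<lambda>n. xs (Suc n))"
    by (auto simp: resolution_def)
  then have "S_dist (S_embed (theta (\<lambda>n. m (Suc n)) k)) (f (xs 1)) \<le> (1/2) ^ k"
    using Suc.IH[of "xs 1"] * by simp
  moreover have "f x = S_cons (m 1) (f (xs 1))"
    using coalgebra_morphismD[OF assms(1,2) Suc.prems(1)] * by (metis One_nat_def)
  ultimately show ?case
    using * f by (simp add: theta_Suc S_cons_embed[symmetric] theta_in S_cons_dist S_embed_in S.rep_dist_same)
qed

lemma theta_limit:
  assumes "coalgebra X e" "coalgebra_morphism X e S S_coalg f"
    and "x \<in> carrier X" "resolution X e x m xs"
  shows "limitin SM.mtopology (\<lambda>k. S_embed (theta m k)) (f x) sequentially"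
proof -
  have "(\<lambda>k. (1/2::real) ^ k) \<longlonglongrightarrow> 0"
    by (rule LIMSEQ_realpow_zero) auto
  then have "(\<lambda>k. S_dist (S_embed (theta m k)) (f x)) \<longlonglongrightarrow> 0"
    by (rule Lim_null_comparison[rotated]) (use theta_dist_morphism[OF assms] in auto)
  moreover have "f x \<in> carrier S"
    using assms(2,3) by (auto simp: coalgebra_morphism_def morphism_iff point_preserving_def)
  ultimately show ?thesis
    by (simp add: SM.limitin_metric_dist_null S_embed_in theta_in)
qed

section \<open>Existence of resolutions and of the mediating morphism\<close>

lemma resolution_exists:
  assumes "coalgebra X e" "x \<in> carrier X"
  obtains m xs where "resolution X e x m xs"
proof -
  obtain \<mu> \<nu> where step: "\<And>y. y \<in> carrier X \<Longrightarrow> \<nu> y \<in> carrier X \<and> e y = \<mu> y \<otimes>\<^bsub>X\<^esub> \<nu> y"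
    by (rule coalgebra_steps[OF assms(1)]) blast
  define xs where "xs n = (\<nu> ^^ n) x" for n
  have xs: "xs n \<in> carrier X" for n
    unfolding xs_def using assms(2) step by (induction n) auto
  have "e (xs (n - 1)) = \<mu> (xs (n - 1)) \<otimes>\<^bsub>X\<^esub> xs n" if "1 \<le> n" for n
    using that step[OF xs[of "n - 1"]] by (cases n) (simp_all add: xs_def)
  \<comment> \<open>The letter at index \<open>n\<close> is read off at \<open>xs (n - 1)\<close>;
    at index 0 truncated subtraction gives the arbitrary value \<open>\<mu> x\<close>.\<close>
  then have "resolution X e x (\<lambda>n. \<mu> (xs (n - 1))) xs"
    unfolding resolution_def using xs by (simp add: xs_def)
  then show ?thesis
    by (rule that)
qed

text \<open>One choice of \<open>m \<otimes> y = e x\<close> for every \<open>x\<close> is fixed, so that the approximating sequence of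
  \<open>x\<close> is, up to the first letter, the shifted one of \<open>y\<close>. Starting from a point-preserving function
  makes it constant at the distinguished elements.\<close>

lemma coalgebra_morphism_exists:
  fixes X :: "'a tripointed"
  assumes X: "coalgebra X e"
  obtains f where "coalgebra_morphism X e S S_coalg f"
proof -
  have tri: "tripointed_set X" and e: "point_preserving X (F_obj X) e"
    using X by (auto simp: coalgebra_def morphism_iff)
  obtain \<mu> \<nu> where step: "\<And>x. x \<in> carrier X \<Longrightarrow> \<nu> x \<in> carrier X \<and> e x = \<mu> x \<otimes>\<^bsub>X\<^esub> \<nu> x"
    by (rule coalgebra_steps[OF X]) blast
  \<comment> \<open>No gluing involves the corners, so their classes are singletons and the choice
    there is forced.\<close>
  have "\<mu> x = m \<and> \<nu> x = x"
    if "(m, x) \<in> {(Ma, Tpt X), (Mb, Lpt X), (Mc, Rpt X)}" for m x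
  proof -
    have x: "x \<in> carrier X" and "e x = m \<otimes>\<^bsub>X\<^esub> x"
      using that tri e by (auto simp: tripointed_set_def point_preserving_def F_obj_def)
    then have "((m, x), (\<mu> x, \<nu> x)) \<in> glue_equiv X"
      using step[OF x] tensor_eq_iff[of x X "\<nu> x" m "\<mu> x"] by simp
    then show ?thesis
      using that tri by (auto simp: glue_equiv_iff glue_def tripointed_set_def)
  qed
  then have pts: "\<mu> (Tpt X) = Ma" "\<nu> (Tpt X) = Tpt X" "\<mu> (Lpt X) = Mb" "\<nu> (Lpt X) = Lpt X"
    "\<mu> (Rpt X) = Mc" "\<nu> (Rpt X) = Rpt X"
    by auto
  \<comment> \<open>The first \<open>k\<close> letters are applied to a base point for the
    \<open>k\<close>-th iterate of \<open>\<nu>\<close>. Unlike in \<open>theta\<close>, the last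
    letter does not determine the base point, and \<open>Tpt G\<close> is an arbitrary value at the
    other elements; the formula with \<open>theta\<close> comes from
    \<open>theta_limit\<close>.\<close>
  define \<theta> where "\<theta> k = ((\<lambda>h x. G_cons (\<mu> x) (h (\<nu> x))) ^^ k)
    (\<lambda>x. if x = Rpt X then Rpt G else if x = Lpt X then Lpt G else Tpt G)" for k
  have \<theta>_Suc: "\<theta> (Suc k) x = G_cons (\<mu> x) (\<theta> k (\<nu> x))" for k x
    by (simp add: \<theta>_def)
  have in': "\<theta> k x \<in> carrier G" for k x
    by (induction k arbitrary: x) (auto simp: \<theta>_Suc G_cons_in, simp add: \<theta>_def)
  have \<theta>_pts: "\<theta> k (Tpt X) = Tpt G" "\<theta> k (Lpt X) = Lpt G" "\<theta> k (Rpt X) = Rpt G" for k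
    using tri by (induction k) (simp_all add: \<theta>_Suc pts G_cons_pts, simp_all add: \<theta>_def tripointed_set_def)
  \<comment> \<open>Both sides apply the same \<open>k\<close> contractions to points at distance at
    most 1.\<close>
  have dist: "G_dist (\<theta> k x) (\<theta> (k + j) x) \<le> (1/2) ^ k" for k j x
  proof (induction k arbitrary: x)
    case 0
    then show ?case using G.le_one in' by simp
  next
    case (Suc k)
    then show ?case
      by (simp add: \<theta>_Suc G_cons_dist in' G.rep_dist_same)
  qed
  have cauchy: "GM.MCauchy (\<lambda>k. \<theta> k x)" for x
    unfolding GM.MCauchy_def
  proof (intro conjI allI impI)
    fix \<epsilon> :: real
    assume "\<epsilon> > 0"
    then obtain N where N: "(1/2) ^ N < \<epsilon> / 2"
      using real_arch_pow_inv[of "\<epsilon> / 2" "1/2"] by auto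
    have "G_dist (\<theta> n x) (\<theta> k x) < \<epsilon>" if "N \<le> n" "N \<le> k" for n k
      using N dist[of N x "n - N"] dist[of N x "k - N"] that
        GM.triangle[of "\<theta> n x" "\<theta> N x" "\<theta> k x"] GM.commute[of "\<theta> n x" "\<theta> N x"] in'
      by simp
    then show "\<exists>N. \<forall>n k. N \<le> n \<longrightarrow> N \<le> k \<longrightarrow> G_dist (\<theta> n x) (\<theta> k x) < \<epsilon>"
      by blast
  qed (use in' in auto)
  define f where "f = (\<lambda>x\<in>carrier X. S_class (\<lambda>k. \<theta> k x))"
  have "morphism X S f"
    using tri by (auto simp: morphism_iff point_preserving_def f_def S_class_in cauchy \<theta>_pts S_pts
        S_embed_eq tripointed_set_def)
  moreover have "f x = S_cons (\<mu> x) (f (\<nu> x))" if "x \<in> carrier X" for x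
  proof -
    \<comment> \<open>Dropping the first term keeps the class, and \<open>\<theta>_Suc\<close> then
      splits off the common first letter.\<close>
    have "S_class (\<lambda>k. \<theta> (Suc k) x) = S_class (\<lambda>k. \<theta> k x)"
      using S_class_subseq[OF cauchy, of Suc] by (simp add: o_def strict_mono_def)
    then show ?thesis
      using that step by (simp add: f_def \<theta>_Suc S_cons_class cauchy)
  qed
  ultimately have "coalgebra_morphism X e S S_coalg f"
    using X step by (intro coalgebra_morphismI) blast+
  then show ?thesis
    by (rule that)
qed

theorem theorem1:
  shows "coalgebra S S_coalg \<and>
    (\<forall>(X :: 'a tripointed) e. coalgebra X e \<longrightarrow>
      (\<exists>!f. coalgebra_morphism X e S S_coalg f) \<and>
      (\<forall>f. coalgebra_morphism X e S S_coalg f \<longrightarrow>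
        (\<forall>x\<in>carrier X. \<forall>m xs. resolution X e x m xs \<longrightarrow>
          limitin (Metric_space.mtopology (carrier S) S_dist)
            (\<lambda>k. S_embed (theta m k)) (f x) sequentially)))"
proof (intro conjI allI impI ballI)
  fix X :: "'a tripointed" and e
  assume X: "coalgebra X e"
  obtain f where f: "coalgebra_morphism X e S S_coalg f"
    using coalgebra_morphism_exists[OF X] .
  show "\<exists>!f. coalgebra_morphism X e S S_coalg f"
  proof (rule ex1I[of _ f])
    fix h
    assume h: "coalgebra_morphism X e S S_coalg h"
    have "h x = f x" if x: "x \<in> carrier X" for x
    proof -
      \<comment> \<open>\<open>theta m\<close> does not depend on the morphism, so one resolution
        makes \<open>h x\<close> and \<open>f x\<close> limits of the same sequence.\<close>
      obtain m xs where r: "resolution X e x m xs"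
        using resolution_exists[OF X x] .
      show ?thesis
        using SM.limitin_metric_unique[OF theta_limit[OF X h x r] theta_limit[OF X f x r]] by simp
    qed
    \<comment> \<open>Morphisms are extensional, so agreement on the carrier gives equality.\<close>
    then show "h = f"
      using f h by (auto simp: coalgebra_morphism_def morphism_iff intro: extensionalityI)
  qed (rule f)
qed (rule coalgebra_S, rule theta_limit)

end
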